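(* Let $G$ be a finite, simple, connected unicyclic graph whose unique cycle has length $\ell$, and suppose exactly $k\ge 2$ vertices of the cycle have degree at least $3$ in $G$. If both $k$ and $\ell$ are even, then $\mathrm{mob}(G)\le \frac{k}{2}+2$. Moreover this bound is tight: there exist such graphs (with $k,\ell$ even) for which $\mathrm{mob}(G)=\frac{k}{2}+2$.
   Context: A unicyclic graph is a connected graph containing exactly one cycle. A set $S$ of vertices is a general position set if no three distinct vertices of $S$ lie on a common shortest path. Place one robot on each vertex of a general position set $S$; robots move one at a time, and a move is legal if a robot moves to an adjacent unoccupied vertex and the new set of occupied vertices is again a general position set. $S$ is a mobile general position set if some finite sequence of legal moves results in every vertex of $G$ being occupied by some robot at some moment. $\mathrm{mob}(G)$ is the maximum cardinality of a mobile general position set of $G$. *)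

theory Defs
  imports Main
begin

definition simple_graph :: "'a set \<Rightarrow> ('a \<Rightarrow> 'a \<Rightarrow> bool) \<Rightarrow> bool" where
  "simple_graph V E \<longleftrightarrow> finite V \<and>
     (\<forall>u v. E u v \<longrightarrow> u \<in> V \<and> v \<in> V \<and> u \<noteq> v \<and> E v u)"

definition walk :: "('a \<Rightarrow> 'a \<Rightarrow> bool) \<Rightarrow> 'a list \<Rightarrow> bool" where
  "walk E p \<longleftrightarrow> p \<noteq> [] \<and> (\<forall>i. Suc i < length p \<longrightarrow> E (p ! i) (p ! Suc i))"

definition connected_graph :: "'a set \<Rightarrow> ('a \<Rightarrow> 'a \<Rightarrow> bool) \<Rightarrow> bool" where
  "connected_graph V E \<longleftrightarrow> (\<forall>x\<in>V. \<forall>y\<in>V. \<exists>p. walk E p \<and> hd p = x \<and> last p = y)"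

definition gdist :: "('a \<Rightarrow> 'a \<Rightarrow> bool) \<Rightarrow> 'a \<Rightarrow> 'a \<Rightarrow> nat" where
  "gdist E x y = (LEAST n. \<exists>p. walk E p \<and> hd p = x \<and> last p = y \<and> length p = Suc n)"

definition shortest_path :: "('a \<Rightarrow> 'a \<Rightarrow> bool) \<Rightarrow> 'a list \<Rightarrow> bool" where
  "shortest_path E p \<longleftrightarrow> walk E p \<and> length p = Suc (gdist E (hd p) (last p))"

definition degree :: "'a set \<Rightarrow> ('a \<Rightarrow> 'a \<Rightarrow> bool) \<Rightarrow> 'a \<Rightarrow> nat" where
  "degree V E v = card {u \<in> V. E v u}"

definition is_cycle :: "'a set \<Rightarrow> ('a \<Rightarrow> 'a \<Rightarrow> bool) \<Rightarrow> 'a list \<Rightarrow> bool" where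
  "is_cycle V E c \<longleftrightarrow> 3 \<le> length c \<and> distinct c \<and> set c \<subseteq> V \<and>
     (\<forall>i < length c. E (c ! i) (c ! ((Suc i) mod length c)))"

definition cycle_edges :: "'a list \<Rightarrow> 'a set set" where
  "cycle_edges c = {{c ! i, c ! ((Suc i) mod length c)} | i. i < length c}"

definition unicyclic :: "'a set \<Rightarrow> ('a \<Rightarrow> 'a \<Rightarrow> bool) \<Rightarrow> bool" where
  "unicyclic V E \<longleftrightarrow> simple_graph V E \<and> connected_graph V E \<and>
     (\<exists>!C. \<exists>c. is_cycle V E c \<and> C = cycle_edges c)"

definition gp_set :: "'a set \<Rightarrow> ('a \<Rightarrow> 'a \<Rightarrow> bool) \<Rightarrow> 'a set \<Rightarrow> bool" where
  "gp_set V E S \<longleftrightarrow> S \<subseteq> V \<and>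
     (\<forall>u\<in>S. \<forall>v\<in>S. \<forall>w\<in>S. u \<noteq> v \<and> v \<noteq> w \<and> u \<noteq> w \<longrightarrow>
        \<not> (\<exists>p. shortest_path E p \<and> u \<in> set p \<and> v \<in> set p \<and> w \<in> set p))"

definition legal_move :: "'a set \<Rightarrow> ('a \<Rightarrow> 'a \<Rightarrow> bool) \<Rightarrow> 'a set \<Rightarrow> 'a set \<Rightarrow> bool" where
  "legal_move V E S S' \<longleftrightarrow> (\<exists>u v. u \<in> S \<and> v \<in> V \<and> v \<notin> S \<and> E u v \<and>
      S' = insert v (S - {u}) \<and> gp_set V E S')"

definition mobile_gp_set :: "'a set \<Rightarrow> ('a \<Rightarrow> 'a \<Rightarrow> bool) \<Rightarrow> 'a set \<Rightarrow> bool" where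
  "mobile_gp_set V E S \<longleftrightarrow> gp_set V E S \<and>
     (\<exists>(seq :: nat \<Rightarrow> 'a set) m. seq 0 = S \<and>
        (\<forall>i < m. legal_move V E (seq i) (seq (Suc i))) \<and>
        (\<Union>i \<le> m. seq i) = V)"

definition mob :: "'a set \<Rightarrow> ('a \<Rightarrow> 'a \<Rightarrow> bool) \<Rightarrow> nat" where
  "mob V E = Max (card ` {S. mobile_gp_set V E S})"

end

theory Submission
  imports Defs
begin

text \<open>
  In a tree hanging off the cycle, three robots separated by a common vertex can never bring a robot
  to that vertex. Hence at least three mobile robots always have distinct projections to the cycle
  of length \<open>2 * h\<close>, and a robot standing on the cycle confines the projections of all others to
  \<open>h\<close> consecutive vertices; for four or more robots at most two stand on the cycle.
  Cut the cycle into two halves containing \<open>k / 2\<close> attachment vertices each. With more than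
  \<open>k / 2 + 2\<close> robots, the robots off the cycle always meet both halves, so whenever the cycle is
  occupied the other robots pass exactly one of the two boundaries between the halves. Which one
  does not change under moves, and the vertex behind that boundary can then never be visited.
\<close>

section \<open>Walks and distances\<close>

text \<open>The constant comes from a count of exceptions. A boundary is determined only while the
  cycle is occupied; with every robot inside a tree, nothing confines the projections to half of the
  cycle. The invariant therefore tolerates discarding one position in that phase: that of the robot
  that left the cycle last. When the next robot enters, at most these two positions are lost; while
  the cycle is occupied, at most two robots stand on it. Either way, out of
  \<open>\<kappa> + 3\<close> distinct positions at least \<open>\<kappa> + 1\<close> attachment
  positions survive, one more than a half can hold, so old and new readings share a pair from
  different halves and must agree. Both parities shape the inequalities: on a cycle of length
  \<open>2 * h\<close> both arcs between antipodal vertices are shortest, which makes the bounds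
  strict, and for even \<open>k\<close> some rotation splits the attachment vertices equally. The
  cut is made at positions \<open>0\<close> and \<open>h\<close>; a robot standing on either one
  forces the opposite answer to the other, although both must be visited.\<close>

lemma walk_iff_relpowp:
  "(\<exists>p. walk E p \<and> hd p = x \<and> last p = y \<and> length p = Suc n) \<longleftrightarrow> (E ^^ n) x y"
proof
  assume "\<exists>p. walk E p \<and> hd p = x \<and> last p = y \<and> length p = Suc n"
  then obtain p where p: "walk E p" "hd p = x" "last p = y" "length p = Suc n" by blast
  then have "p \<noteq> []" by auto
  with p have "p ! 0 = x" "p ! n = y" "\<forall>i<n. E (p ! i) (p ! Suc i)"
    by (auto simp: walk_def hd_conv_nth last_conv_nth)
  then show "(E ^^ n) x y"
    unfolding relpowp_fun_conv by (intro exI[of _ "nth p"]) auto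
next
  assume "(E ^^ n) x y"
  then obtain f where f: "f 0 = x" "f n = y" "\<forall>i<n. E (f i) (f (Suc i))"
    unfolding relpowp_fun_conv by blast
  have "walk E (map f [0..<Suc n])"
    unfolding walk_def using f(3) by (auto simp del: upt_Suc)
  moreover have "hd (map f [0..<Suc n]) = x" "last (map f [0..<Suc n]) = y"
    using f by (auto simp: hd_map last_map simp del: upt_Suc)
  ultimately show "\<exists>p. walk E p \<and> hd p = x \<and> last p = y \<and> length p = Suc n"
    by (intro exI[of _ "map f [0..<Suc n]"]) simp
qed

lemma gdist_eq_LEAST_relpowp: "gdist E x y = (LEAST n. (E ^^ n) x y)"
  unfolding gdist_def walk_iff_relpowp ..

lemma gdist_le: "(E ^^ n) x y \<Longrightarrow> gdist E x y \<le> n"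
  unfolding gdist_eq_LEAST_relpowp by (rule Least_le)

lemma gdist_relpowp: "(E ^^ n) x y \<Longrightarrow> (E ^^ gdist E x y) x y"
  unfolding gdist_eq_LEAST_relpowp by (rule LeastI)

lemma relpowp_add_intro:
  assumes "(E ^^ m) x y" "(E ^^ n) y z"
  shows "(E ^^ (m + n)) x z"
  using assms unfolding relpowp_add by blast

lemma relpowp_sym:
  assumes "\<And>x y. E x y \<Longrightarrow> E y x" "(E ^^ n) x y"
  shows "(E ^^ n) y x"
  using assms(2)
proof (induction n arbitrary: y)
  case (Suc n)
  then obtain z where "(E ^^ n) x z" "E z y" by auto
  with Suc.IH assms(1) have "(E ^^ n) z x" "E y z" by auto
  then show ?case by (metis relpowp_Suc_I2)
qed simp

text \<open>All lower bounds on distances rest on this: a potential that rises by at most one along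
  each edge certifies them.\<close>

lemma relpowp_lipschitz:
  fixes \<phi> :: "'a \<Rightarrow> int"
  assumes "\<And>u v. E u v \<Longrightarrow> \<phi> v \<le> \<phi> u + 1" "(E ^^ n) x y"
  shows "\<phi> y \<le> \<phi> x + int n"
  using assms(2)
proof (induction n arbitrary: y)
  case (Suc n)
  then obtain z where "(E ^^ n) x z" "E z y" by auto
  with Suc.IH[of z] assms(1)[of z y] show ?case by simp
qed simp

lemma shortest_path_through:
  assumes "(E ^^ m) a b" "(E ^^ n) b c" "m + n \<le> gdist E a c"
  shows "\<exists>p. shortest_path E p \<and> a \<in> set p \<and> b \<in> set p \<and> c \<in> set p"
proof -
  from assms(1) obtain f where f: "f 0 = a" "f m = b" "\<forall>i<m. E (f i) (f (Suc i))"
    unfolding relpowp_fun_conv by blast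
  from assms(2) obtain g where g: "g 0 = b" "g n = c" "\<forall>i<n. E (g i) (g (Suc i))"
    unfolding relpowp_fun_conv by blast
  define h where "h i = (if i \<le> m then f i else g (i - m))" for i
  define p where "p = map h [0..<Suc (m + n)]"
  have edge: "E (h i) (h (Suc i))" if "i < m + n" for i
  proof (cases "i < m")
    case True then show ?thesis using f by (simp add: h_def)
  next
    case False
    then have "h i = g (i - m)" using f g by (auto simp: h_def)
    moreover have "h (Suc i) = g (Suc (i - m))" using False by (simp add: h_def Suc_diff_le)
    moreover have "i - m < n" using that False by linarith
    ultimately show ?thesis using g by simp
  qed
  have h0: "h 0 = a" and hm: "h m = b" and hn: "h (m + n) = c"
    using f g by (auto simp: h_def)
  have "walk E p" unfolding walk_def p_def using edge by (auto simp del: upt_Suc)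
  moreover have "hd p = a" "last p = c"
    unfolding p_def using h0 hn by (auto simp: hd_map last_map simp del: upt_Suc)
  moreover have "gdist E a c \<le> m + n"
    by (rule gdist_le) (rule relpowp_add_intro[OF assms(1,2)])
  ultimately have "shortest_path E p"
    using assms(3) by (simp add: shortest_path_def p_def)
  moreover have "set p = h ` {0..m + n}"
    unfolding p_def by (simp del: upt_Suc add: atLeastLessThanSuc_atLeastAtMost)
  then have "a \<in> set p" "b \<in> set p" "c \<in> set p"
    using h0 hm hn by (metis atLeastAtMost_iff imageI le_add1 order_refl zero_le)+
  ultimately show ?thesis by blast
qed

text \<open>A shorter connection between two vertices of the path could be spliced in and would
  shorten the whole path.\<close>

lemma shortest_path_gdist:
  assumes "shortest_path E p" "i \<le> j" "j < length p"
  shows "gdist E (p ! i) (p ! j) = j - i"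
proof -
  let ?n = "length p - 1"
  have w: "walk E p" and len: "length p = Suc (gdist E (hd p) (last p))"
    using assms(1) by (auto simp: shortest_path_def)
  have ne: "p \<noteq> []" using w by (simp add: walk_def)
  have sub: "(E ^^ (b - a)) (p ! a) (p ! b)" if "a \<le> b" "b < length p" for a b
    unfolding relpowp_fun_conv
    by (rule exI[of _ "\<lambda>k. p ! (a + k)"]) (use w that in \<open>auto simp: walk_def\<close>)
  have "(E ^^ (j - i)) (p ! i) (p ! j)" using sub assms by simp
  then have le: "gdist E (p ! i) (p ! j) \<le> j - i" and
    d: "(E ^^ gdist E (p ! i) (p ! j)) (p ! i) (p ! j)" by (auto intro: gdist_le gdist_relpowp)
  have "(E ^^ (i - 0 + gdist E (p ! i) (p ! j) + (?n - j))) (p ! 0) (p ! ?n)"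
    using sub[of 0 i] sub[of j ?n] d assms by (intro relpowp_add_intro) auto
  then have "gdist E (hd p) (last p) \<le> i + gdist E (p ! i) (p ! j) + (?n - j)"
    using ne gdist_le by (fastforce simp: hd_conv_nth last_conv_nth)
  then show ?thesis using le len assms by linarith
qed

lemma shortest_path_collinear:
  assumes "shortest_path E p" "u \<in> set p" "v \<in> set p" "w \<in> set p"
  shows "\<exists>x y z. {x, y, z} = {u, v, w} \<and> gdist E x y + gdist E y z = gdist E x z"
proof -
  obtain i j k where ijk: "i < length p" "p ! i = u" "j < length p" "p ! j = v"
      "k < length p" "p ! k = w"
    using assms by (metis in_set_conv_nth)
  have *: "gdist E (p ! a) (p ! b) + gdist E (p ! b) (p ! d) = gdist E (p ! a) (p ! d)"
    if "a \<le> b" "b \<le> d" "d < length p" for a b d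
    using shortest_path_gdist[OF assms(1)] that by simp
  consider "i \<le> j \<and> j \<le> k" | "i \<le> k \<and> k \<le> j" | "j \<le> i \<and> i \<le> k" | "j \<le> k \<and> k \<le> i"
    | "k \<le> i \<and> i \<le> j" | "k \<le> j \<and> j \<le> i" by linarith
  then show ?thesis
  proof cases
    case 1 then show ?thesis using *[of i j k] ijk by (intro exI[of _ u] exI[of _ v] exI[of _ w]) auto
  next
    case 2 then show ?thesis using *[of i k j] ijk by (intro exI[of _ u] exI[of _ w] exI[of _ v]) auto
  next
    case 3 then show ?thesis using *[of j i k] ijk by (intro exI[of _ v] exI[of _ u] exI[of _ w]) auto
  next
    case 4 then show ?thesis using *[of j k i] ijk by (intro exI[of _ v] exI[of _ w] exI[of _ u]) auto
  next
    case 5 then show ?thesis using *[of k i j] ijk by (intro exI[of _ w] exI[of _ u] exI[of _ v]) auto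
  next
    case 6 then show ?thesis using *[of k j i] ijk by (intro exI[of _ w] exI[of _ v] exI[of _ u]) auto
  qed
qed

section \<open>Robots in a connected graph\<close>

locale conn_graph =
  fixes V :: "'a set" and E :: "'a \<Rightarrow> 'a \<Rightarrow> bool"
  assumes simple: "simple_graph V E" and conn: "connected_graph V E"
begin

lemma finite_V: "finite V" using simple by (simp add: simple_graph_def)
lemma E_sym: "E u v \<Longrightarrow> E v u" using simple by (auto simp: simple_graph_def)
lemma E_irrefl: "\<not> E u u" using simple by (auto simp: simple_graph_def)
lemma E_in: "E u v \<Longrightarrow> u \<in> V \<and> v \<in> V" using simple by (auto simp: simple_graph_def)

lemma connected_relpowp:
  assumes "x \<in> V" "y \<in> V"
  shows "\<exists>n. (E ^^ n) x y"
proof -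
  obtain p where p: "walk E p" "hd p = x" "last p = y"
    using conn assms unfolding connected_graph_def by blast
  moreover have "p \<noteq> []" using p by (simp add: walk_def)
  then have "length p = Suc (length p - 1)" by (cases p) auto
  ultimately show ?thesis using walk_iff_relpowp[of E x y "length p - 1"] by blast
qed

lemma gp_set_not_collinear:
  assumes "gp_set V E S" "a \<in> S" "b \<in> S" "c \<in> S" "a \<noteq> b" "b \<noteq> c" "a \<noteq> c"
    "shortest_path E p" "a \<in> set p" "b \<in> set p" "c \<in> set p"
  shows False
  using assms unfolding gp_set_def by blast

text \<open>Expresses without mentioning paths that \<open>X\<close> is a union of components of the
  graph with \<open>m\<close> deleted.\<close>

definition closed_off :: "'a \<Rightarrow> 'a set \<Rightarrow> bool" where
  "closed_off m X \<longleftrightarrow> m \<notin> X \<and> (\<forall>u v. u \<in> X \<longrightarrow> E u v \<longrightarrow> v \<in> X \<or> v = m)"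

text \<open>A walk can leave \<open>X\<close> only through \<open>m\<close>, so a shortest path from
  \<open>a\<close> to \<open>d\<close> contains \<open>m\<close>, which cannot carry a third
  robot.\<close>

lemma gp_set_separated:
  assumes gp: "gp_set V E S" and X: "closed_off m X" and "a \<in> S \<inter> X" "d \<in> S - X" "d \<noteq> m"
  shows "m \<notin> S"
proof
  assume m: "m \<in> S"
  have "a \<in> V" "d \<in> V" using assms by (auto simp: gp_set_def)
  then have "(E ^^ gdist E a d) a d" using connected_relpowp gdist_relpowp by metis
  then obtain f where f: "f 0 = a" "f (gdist E a d) = d"
      "\<forall>i<gdist E a d. E (f i) (f (Suc i))"
    unfolding relpowp_fun_conv by blast
  have "\<exists>i\<le>gdist E a d. f i = m"
  proof (rule ccontr)
    assume no: "\<not> ?thesis"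
    have "i \<le> gdist E a d \<Longrightarrow> f i \<in> X" for i
    proof (induction i)
      case 0 then show ?case using f assms by simp
    next
      case (Suc i)
      then have "f i \<in> X" "E (f i) (f (Suc i))" using f by auto
      then have "f (Suc i) \<in> X \<or> f (Suc i) = m" using X unfolding closed_off_def by blast
      then show ?case using no Suc.prems by blast
    qed
    from this[of "gdist E a d"] show False using f(2) assms(4) by simp
  qed
  then obtain i where i: "i \<le> gdist E a d" "f i = m" by blast
  have 1: "(E ^^ i) a m" unfolding relpowp_fun_conv
    by (rule exI[of _ f]) (use f i in auto)
  have 2: "(E ^^ (gdist E a d - i)) m d" unfolding relpowp_fun_conv
    by (rule exI[of _ "\<lambda>k. f (i + k)"]) (use f i in auto)
  have "\<exists>p. shortest_path E p \<and> a \<in> set p \<and> m \<in> set p \<and> d \<in> set p"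
    by (rule shortest_path_through[OF 1 2]) (use i in simp)
  moreover have "a \<noteq> m" "a \<noteq> d" using assms by (auto simp: closed_off_def)
  ultimately show False
    using gp_set_not_collinear[OF gp, of a m d] assms m by blast
qed

text \<open>Unlike \<open>legal_move\<close>, this asks for general position before and after the
  move. The relation is thus symmetric, and invariants can be carried backwards in time.\<close>

definition step :: "'a set \<Rightarrow> 'a set \<Rightarrow> bool" where
  "step S S' \<longleftrightarrow> gp_set V E S \<and> gp_set V E S' \<and>
     (\<exists>u v. u \<in> S \<and> v \<notin> S \<and> E u v \<and> S' = insert v (S - {u}))"

lemma step_sym:
  assumes "step S S'"
  shows "step S' S"
proof -
  from assms obtain u v where uv: "u \<in> S" "v \<notin> S" "E u v" "S' = insert v (S - {u})"
    unfolding step_def by blast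
  then have "v \<in> S'" "u \<notin> S'" "E v u" "S = insert u (S' - {v})" using E_sym by auto
  then show ?thesis using assms unfolding step_def by blast
qed

text \<open>For disjoint closed-off \<open>X\<close> and \<open>Y\<close>, the graph without
  \<open>m\<close> falls into \<open>X\<close>, \<open>Y\<close> and the rest, and each of the three
  parts holds a robot.\<close>

definition tripod :: "'a \<Rightarrow> 'a set \<Rightarrow> 'a set \<Rightarrow> 'a set \<Rightarrow> bool" where
  "tripod m X Y S \<longleftrightarrow> S \<inter> X \<noteq> {} \<and> S \<inter> Y \<noteq> {} \<and> S - insert m (X \<union> Y) \<noteq> {}"

lemma tripod_not_mem:
  assumes "gp_set V E S" "closed_off m X" "tripod m X Y S" "X \<inter> Y = {}"
  shows "m \<notin> S"
proof -
  obtain a d where "a \<in> S \<inter> X" "d \<in> S - insert m (X \<union> Y)"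
    using assms(3) unfolding tripod_def by auto
  then show ?thesis using gp_set_separated[OF assms(1,2), of a d] by auto
qed

text \<open>A move to \<open>m\<close> would leave robots in two different parts with
  \<open>m\<close> between them; any other move stays inside its part.\<close>

lemma tripod_step:
  assumes "step S S'" and X: "closed_off m X" and Y: "closed_off m Y" and dis: "X \<inter> Y = {}"
    and "tripod m X Y S"
  shows "tripod m X Y S'"
proof -
  from assms(1) obtain u v where uv: "u \<in> S" "v \<notin> S" "E u v" "S' = insert v (S - {u})"
    and gp': "gp_set V E S'" unfolding step_def by blast
  obtain a b d where abd: "a \<in> S \<inter> X" "b \<in> S \<inter> Y" "d \<in> S - insert m (X \<union> Y)"
    using assms(5) unfolding tripod_def by auto
  have m: "m \<notin> S" using tripod_not_mem assms uv unfolding step_def by blast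
  have v: "v \<noteq> m"
  proof
    assume "v = m"
    then have "m \<in> S'" using uv by simp
    have "a \<noteq> b" "d \<noteq> a" "d \<noteq> b" "d \<noteq> m" "a \<notin> Y" "b \<notin> X" "a \<noteq> m" "b \<noteq> m" "d \<notin> X" "d \<notin> Y"
      using abd dis m by auto
    \<comment> \<open>Only one robot has moved, so at least two of the three witnesses are still in
      place.\<close>
    then consider "a \<in> S'" "b \<in> S'" | "a \<in> S'" "d \<in> S'" | "b \<in> S'" "d \<in> S'"
      using uv abd by blast
    then show False
    proof cases
      case 1
      then show ?thesis using gp_set_separated[OF gp' X, of a b] abd \<open>m \<in> S'\<close> \<open>b \<notin> X\<close> \<open>b \<noteq> m\<close> by auto
    next
      case 2
      then show ?thesis using gp_set_separated[OF gp' X, of a d] abd \<open>m \<in> S'\<close> \<open>d \<noteq> m\<close> by auto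
    next
      case 3
      then show ?thesis using gp_set_separated[OF gp' Y, of b d] abd \<open>m \<in> S'\<close> \<open>d \<noteq> m\<close> by auto
    qed
  qed
  have "v \<in> X \<longleftrightarrow> u \<in> X" "v \<in> Y \<longleftrightarrow> u \<in> Y"
    using X Y uv E_sym v m unfolding closed_off_def by metis+
  then have "S' \<inter> X \<noteq> {}" "S' \<inter> Y \<noteq> {}" "S' - insert m (X \<union> Y) \<noteq> {}"
    using abd uv v by (cases "u = a"; cases "u = b"; cases "u = d"; blast)+
  then show ?thesis by (simp add: tripod_def)
qed

lemma mobile_gp_setE:
  assumes "mobile_gp_set V E S"
  obtains seq m where "seq (0::nat) = S" "\<And>i. i < m \<Longrightarrow> step (seq i) (seq (Suc i))"
    "\<And>i. i \<le> m \<Longrightarrow> gp_set V E (seq i)" "(\<Union>i\<le>m. seq i) = V"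
proof -
  obtain seq m where s: "seq (0::nat) = S" "\<forall>i<m. legal_move V E (seq i) (seq (Suc i))"
    "(\<Union>i\<le>m. seq i) = V" and gp0: "gp_set V E S" using assms unfolding mobile_gp_set_def by blast
  have gp: "i \<le> m \<Longrightarrow> gp_set V E (seq i)" for i
    using s gp0 by (cases i) (auto simp: legal_move_def Suc_le_eq)
  have "step (seq i) (seq (Suc i))" if "i < m" for i
    using s(2) gp[of i] gp[of "Suc i"] that unfolding step_def legal_move_def
    by (metis Suc_leI less_imp_le)
  with s gp that show ?thesis by blast
qed

lemma gp_set_finite: "gp_set V E S \<Longrightarrow> finite S"
  using finite_V finite_subset by (auto simp: gp_set_def)

lemma step_card: "step S S' \<Longrightarrow> card S' = card S"
proof -
  assume "step S S'"
  then obtain u v where "u \<in> S" "v \<notin> S" "S' = insert v (S - {u})" "finite S"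
    unfolding step_def using gp_set_finite by blast
  then show ?thesis using card_Suc_Diff1[of S u] by simp
qed

lemma ex_walk_covering:
  assumes "x \<in> V" "finite F" "F \<subseteq> V"
  shows "\<exists>f n. f 0 = x \<and> (\<forall>i<n. E (f i) (f (Suc i))) \<and> F \<subseteq> f ` {..(n::nat)}"
  using assms(2,3)
proof (induction F rule: finite_induct)
  case empty
  show ?case by (intro exI[of _ "\<lambda>_. x"] exI[of _ 0]) simp
next
  case (insert y F)
  then obtain f n where f: "f 0 = x" "\<forall>i<n. E (f i) (f (Suc i))" "F \<subseteq> f ` {..n}" by auto
  have "f n \<in> V" using f assms(1) E_in by (cases n) auto
  then obtain m where "(E ^^ m) (f n) y" using connected_relpowp[of "f n" y] insert.prems by blast
  then obtain g where g: "g 0 = f n" "g m = y" "\<forall>i<m. E (g i) (g (Suc i))"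
    unfolding relpowp_fun_conv by blast
  define h where "h i = (if i \<le> n then f i else g (i - n))" for i
  have "E (h i) (h (Suc i))" if "i < n + m" for i
  proof (cases "i < n")
    case True then show ?thesis using f by (simp add: h_def)
  next
    case False
    then have "h i = g (i - n)" using f g by (auto simp: h_def)
    moreover have "h (Suc i) = g (Suc (i - n))" using False by (simp add: h_def Suc_diff_le)
    moreover have "i - n < m" using that False by linarith
    ultimately show ?thesis using g by simp
  qed
  moreover have "h (n + m) = y" using g by (auto simp: h_def)
  moreover have "f ` {..n} \<subseteq> h ` {..n + m}" by (auto simp: h_def intro!: image_eqI)
  moreover have "h 0 = x" using f by (simp add: h_def)
  ultimately show ?case using f
    by (intro exI[of _ h] exI[of _ "n + m"]) (auto intro!: image_eqI[of y h "n + m"])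
qed

text \<open>A single robot follows a walk through all vertices. This keeps the set under
  \<open>Max\<close> in \<open>mob\<close> nonempty.\<close>

lemma mobile_gp_set_singleton:
  assumes "x \<in> V"
  shows "mobile_gp_set V E {x}"
proof -
  obtain f n where f: "f 0 = x" "\<forall>i<n. E (f i) (f (Suc i))" "V \<subseteq> f ` {..(n::nat)}"
    using ex_walk_covering[OF assms finite_V order_refl] by blast
  have fV: "f i \<in> V" if "i \<le> n" for i
    using f assms E_in that by (cases i) (auto simp: Suc_le_eq)
  have gp: "gp_set V E {y}" if "y \<in> V" for y
    using that by (auto simp: gp_set_def)
  have "legal_move V E {f i} {f (Suc i)}" if "i < n" for i
  proof -
    have "E (f i) (f (Suc i))" "f (Suc i) \<in> V" using f that fV by auto
    moreover from this have "f (Suc i) \<noteq> f i" using E_irrefl by metis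
    ultimately show ?thesis unfolding legal_move_def
      by (intro exI[of _ "f i"] exI[of _ "f (Suc i)"]) (simp add: gp)
  qed
  moreover have "(\<Union>i\<le>n. {f i}) = V" using f fV by auto
  ultimately show ?thesis
    unfolding mobile_gp_set_def using f gp[OF assms]
    by (intro conjI exI[of _ "\<lambda>i. {f i}"] exI[of _ n]) auto
qed

end

section \<open>Configurations on an even cycle\<close>

text \<open>\<open>P\<close> are the projections of the robots to the cycle of length \<open>2 * h\<close>, and \<open>B\<close> those of the robots
  standing on the cycle. Only the latter can lie between two other robots.\<close>

definition free_conf :: "nat \<Rightarrow> nat set \<Rightarrow> nat set \<Rightarrow> bool" where
  "free_conf h P B \<longleftrightarrow> P \<subseteq> {..<2 * h} \<and> B \<subseteq> P \<and>
     (\<forall>q\<in>B. \<forall>x\<in>P - {q}. \<forall>z\<in>P - {q}. x < z \<longrightarrow>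
        (x < q \<and> q < z \<longrightarrow> x + h < z) \<and> (q < x \<or> z < q \<longrightarrow> z < x + h))"

lemma free_conf_inside:
  assumes "free_conf h P B" "q \<in> B" "x \<in> P" "z \<in> P" "x < q" "q < z"
  shows "x + h < z"
proof -
  have "x \<in> P - {q}" "z \<in> P - {q}" using assms by auto
  moreover have "x < z" using assms by linarith
  ultimately show ?thesis using assms unfolding free_conf_def by blast
qed

lemma free_conf_outside:
  assumes "free_conf h P B" "q \<in> B" "x \<in> P" "z \<in> P" "x < z" "q < x \<or> z < q"
  shows "z < x + h"
proof -
  have "x \<in> P - {q}" "z \<in> P - {q}" using assms by auto
  then show ?thesis using assms unfolding free_conf_def by blast
qed

text \<open>Given three positions in \<open>B\<close> and a fourth point \<open>e\<close>, pair
  \<open>e\<close> with the point opposite to it in cyclic order. The other two lie on different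
  arcs of this pair, so both arcs would have to be longer than \<open>h\<close>.\<close>

lemma free_conf_card_le_2:
  assumes f: "free_conf h P B" and "4 \<le> card P"
  shows "card B \<le> 2"
proof (rule ccontr)
  assume "\<not> card B \<le> 2"
  then obtain B' where "B' \<subseteq> B" "card B' = 3"
    by (metis obtain_subset_with_card_n not_less_eq_eq numeral_2_eq_2 numeral_3_eq_3)
  then obtain a b c where abc: "a \<in> B" "b \<in> B" "c \<in> B" "a \<noteq> b" "b \<noteq> c" "a \<noteq> c"
    by (auto simp: card_3_iff)
  have "\<exists>b1 b2 b3. b1 \<in> B \<and> b2 \<in> B \<and> b3 \<in> B \<and> b1 < b2 \<and> b2 < b3"
    using abc by (metis linorder_neqE_nat)
  then obtain b1 b2 b3 where b: "b1 \<in> B" "b2 \<in> B" "b3 \<in> B" "b1 < b2" "b2 < b3" by blast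
  have BP: "B \<subseteq> P" and "finite P" using f finite_subset by (auto simp: free_conf_def)
  have "\<not> P \<subseteq> {b1, b2, b3}"
  proof
    assume "P \<subseteq> {b1, b2, b3}"
    then have "card P \<le> card {b1, b2, b3}" by (intro card_mono) auto
    also have "\<dots> \<le> 3" by (metis card_3_iff b(4,5) less_trans less_irrefl order_refl)
    finally show False using assms(2) by simp
  qed
  then obtain e where e: "e \<in> P" "e \<noteq> b1" "e \<noteq> b2" "e \<noteq> b3" by blast
  have bP: "b1 \<in> P" "b2 \<in> P" "b3 \<in> P" using BP b by auto
  consider "e < b1" | "b1 < e" "e < b2" | "b2 < e" "e < b3" | "b3 < e" using e by linarith
  then show False
  proof cases
    case 1
    then show ?thesis
      using free_conf_inside[OF f b(1), of e b2] free_conf_outside[OF f b(3), of e b2] e b bP by auto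
  next
    case 2
    then show ?thesis
      using free_conf_inside[OF f b(2), of e b3] free_conf_outside[OF f b(1), of e b3] e b bP by auto
  next
    case 3
    then show ?thesis
      using free_conf_inside[OF f b(2), of b1 e] free_conf_outside[OF f b(3), of b1 e] e b bP by auto
  next
    case 4
    then show ?thesis
      using free_conf_inside[OF f b(3), of b2 e] free_conf_outside[OF f b(1), of b2 e] e b bP by auto
  qed
qed

text \<open>A set of positions contained in a half of the cycle of length \<open>2 * h\<close> that meets both
  \<open>{0..<h}\<close> and \<open>{h..<2*h}\<close> passes exactly one of the two boundaries between these halves:
  \<open>\<sigma>\<close> tells whether it is the one before \<open>h\<close> or the one before \<open>0\<close>.\<close>

definition crosses :: "nat \<Rightarrow> bool \<Rightarrow> nat set \<Rightarrow> bool" where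
  "crosses h \<sigma> X \<longleftrightarrow> (\<forall>x\<in>X. \<forall>z\<in>X. x < h \<longrightarrow> h \<le> z \<longrightarrow> (z < x + h) = \<sigma>)"

lemma crosses_mono: "crosses h \<sigma> X \<Longrightarrow> Y \<subseteq> X \<Longrightarrow> crosses h \<sigma> Y"
  unfolding crosses_def by blast

lemma crosses_unique:
  "crosses h \<sigma> X \<Longrightarrow> crosses h \<tau> Y \<Longrightarrow> x \<in> X \<inter> Y \<Longrightarrow> z \<in> X \<inter> Y \<Longrightarrow> x < h \<Longrightarrow> h \<le> z \<Longrightarrow> \<sigma> = \<tau>"
  unfolding crosses_def by blast

text \<open>Two pairs that cross differently put \<open>q\<close> outside one and strictly inside
  the other. Then \<open>q\<close> lies between two points of the same half, which are less than
  \<open>h\<close> apart.\<close>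

lemma free_conf_crosses:
  assumes f: "free_conf h P B" and q: "q \<in> B"
  shows "\<exists>\<sigma>. crosses h \<sigma> (P - {q})"
proof (rule ccontr)
  assume "\<not> ?thesis"
  then have "\<not> crosses h False (P - {q})" "\<not> crosses h True (P - {q})" by blast+
  then obtain x z x' z' where
    x: "x \<in> P" "x \<noteq> q" "z \<in> P" "z \<noteq> q" "x < h" "h \<le> z" "z < x + h" and
    x': "x' \<in> P" "x' \<noteq> q" "z' \<in> P" "z' \<noteq> q" "x' < h" "h \<le> z'" "\<not> z' < x' + h"
    unfolding crosses_def by blast
  have "\<not> (x < q \<and> q < z)" using free_conf_inside[OF f q x(1,3)] x by auto
  then have 1: "q < x \<or> z < q" using x by linarith
  have "\<not> (q < x' \<or> z' < q)" using free_conf_outside[OF f q x'(1,3)] x' by auto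
  then have 2: "x' < q \<and> q < z'" using x' by linarith
  show False
  proof (cases "q < x")
    case True
    then show ?thesis using free_conf_inside[OF f q x'(1) x(1)] 2 x by auto
  next
    case False
    moreover have "z' < 2 * h" using f x'(3) unfolding free_conf_def by auto
    ultimately show ?thesis using free_conf_inside[OF f q x(3) x'(3)] 1 2 x(6) by linarith
  qed
qed

section \<open>The boundary invariant for a balanced cut of the cycle\<close>

locale balanced_marking =
  fixes h \<kappa> :: nat and R :: "nat set"
  assumes finite_R: "finite R" and low: "card (R \<inter> {..<h}) = \<kappa>" and high: "card (R \<inter> {h..}) = \<kappa>"
    and kappa_pos: "1 \<le> \<kappa>"
begin

text \<open>Pigeonhole, since each half contains only \<open>\<kappa>\<close> marks. It excludes the
  case where \<open>crosses\<close> holds vacuously for both truth values.\<close>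

lemma meets_both_halves:
  assumes "X \<subseteq> R" "\<kappa> < card X"
  shows "\<exists>x\<in>X. \<exists>z\<in>X. x < h \<and> h \<le> z"
proof -
  have "\<not> X \<subseteq> R \<inter> {..<h}" "\<not> X \<subseteq> R \<inter> {h..}"
    using assms(2) low high card_mono[of "R \<inter> {..<h}" X] card_mono[of "R \<inter> {h..}" X] finite_R by auto
  then show ?thesis using assms(1) by (auto simp: not_less not_le subset_iff)
qed

definition conf :: "nat set \<Rightarrow> nat set \<Rightarrow> bool" where
  "conf P B \<longleftrightarrow> free_conf h P B \<and> P - B \<subseteq> R \<and> \<kappa> + 3 \<le> card P"

lemma conf_finite: "conf P B \<Longrightarrow> finite P"
  using finite_subset by (auto simp: conf_def free_conf_def)

lemma conf_card:
  assumes "conf P B"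
  shows "\<kappa> < card (P - B)"
proof -
  have "card B \<le> 2" using free_conf_card_le_2 assms kappa_pos unfolding conf_def by force
  moreover have "card P - card B \<le> card (P - B)"
    using assms conf_finite by (intro diff_card_le_card_Diff) (auto simp: conf_def free_conf_def intro: finite_subset)
  ultimately show ?thesis using assms unfolding conf_def by linarith
qed

lemma conf_crosses:
  assumes "conf P B" "B \<noteq> {}"
  obtains \<sigma> where "crosses h \<sigma> (P - B)"
proof -
  obtain q where "q \<in> B" using assms by blast
  then obtain \<sigma> where "crosses h \<sigma> (P - {q})" using free_conf_crosses assms unfolding conf_def by blast
  then have "crosses h \<sigma> (P - B)" using \<open>q \<in> B\<close> by (auto elim!: crosses_mono)
  then show ?thesis using that by blast
qed

text \<open>With the cycle empty, \<open>s\<close> stands for the position where the last robot left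
  the cycle: only the others were known to be confined at that moment.\<close>

definition side :: "bool \<Rightarrow> nat set \<Rightarrow> nat set \<Rightarrow> bool" where
  "side \<sigma> P B \<longleftrightarrow> (if B = {} then \<exists>s. crosses h \<sigma> (P - {s}) else crosses h \<sigma> (P - B))"

lemma crosses_unique_large:
  assumes "crosses h \<sigma> X" "crosses h \<tau> Y" "Z \<subseteq> X \<inter> Y" "Z \<subseteq> R" "\<kappa> < card Z"
  shows "\<sigma> = \<tau>"
proof -
  obtain x z where "x \<in> Z" "z \<in> Z" "x < h" "h \<le> z" using meets_both_halves assms by blast
  then show ?thesis using crosses_unique assms by blast
qed

lemma side_leave_tree:
  assumes c: "conf P B" and c': "conf P (insert q B)" and s: "side \<sigma> P B"
  shows "side \<sigma> P (insert q B)"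
proof -
  obtain \<tau> where t: "crosses h \<tau> (P - insert q B)" using conf_crosses[OF c'] by blast
  have "\<sigma> = \<tau>"
  proof (cases "B = {}")
    case True
    then obtain s where s': "crosses h \<sigma> (P - {s})" using s by (auto simp: side_def)
    \<comment> \<open>The old reading ignores \<open>s\<close> and the new one ignores
      \<open>q\<close>; the surplus of three over \<open>\<kappa>\<close> pays for both.\<close>
    have "card P - card {q, s} \<le> card (P - {q, s})" by (intro diff_card_le_card_Diff) simp
    moreover have "card {q, s} \<le> 2" by (simp add: card_insert_if)
    ultimately have "\<kappa> < card (P - {q, s})" using c unfolding conf_def by linarith
    moreover have "P - {q, s} \<subseteq> R" using c True by (auto simp: conf_def)
    ultimately show ?thesis by (intro crosses_unique_large[OF s' t, of "P - {q, s}"]) (use True in auto)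
  next
    case False
    then have "crosses h \<sigma> (P - B)" using s by (simp add: side_def)
    then show ?thesis
      using conf_card[OF c'] c' by (intro crosses_unique_large[OF _ t, of \<sigma> "P - B" "P - insert q B"]) (auto simp: conf_def)
  qed
  with t show ?thesis by (simp add: side_def)
qed

text \<open>If \<open>q\<close> was the only occupied cycle position, it becomes the discarded
  \<open>s\<close>. Otherwise a remaining cycle robot yields a reading that must agree with the old
  one.\<close>

lemma side_enter_tree:
  assumes c: "conf P (insert q B)" and c': "conf P B" and s: "side \<sigma> P (insert q B)"
  shows "side \<sigma> P B"
proof (cases "B = {}")
  case True
  then show ?thesis using s by (auto simp: side_def)
next
  case False
  obtain \<tau> where t: "crosses h \<tau> (P - B)" using conf_crosses[OF c' False] by blast
  have "crosses h \<sigma> (P - insert q B)" using s by (simp add: side_def)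
  then have "\<sigma> = \<tau>"
    using conf_card[OF c] c by (intro crosses_unique_large[OF _ t, of \<sigma> "P - insert q B" "P - insert q B"]) (auto simp: conf_def)
  with t False show ?thesis by (simp add: side_def)
qed

text \<open>Position \<open>h\<close> lies inside every pair from different halves, so such a pair
  must be close the other way round.\<close>

lemma side_boundary_h:
  assumes c: "conf P B" and "h \<in> B" and "side \<sigma> P B"
  shows "\<not> \<sigma>"
proof -
  have f: "free_conf h P B" using c by (simp add: conf_def)
  have "crosses h False (P - B)"
    unfolding crosses_def using free_conf_inside[OF f assms(2)] assms(2)
    by (metis Diff_iff le_neq_implies_less less_asym)
  moreover have "crosses h \<sigma> (P - B)" using assms by (auto simp: side_def split: if_splits)
  ultimately show ?thesis
    using crosses_unique_large[of \<sigma> "P - B" False "P - B" "P - B"] conf_card[OF c] c by (auto simp: conf_def)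
qed

text \<open>Position \<open>0\<close> lies outside every pair of other positions, so each pair is
  close across the boundary before \<open>h\<close>.\<close>

lemma side_boundary_0:
  assumes c: "conf P B" and "0 \<in> B" and "side \<sigma> P B"
  shows \<sigma>
proof -
  have f: "free_conf h P B" using c by (simp add: conf_def)
  have "z < x + h" if "x \<in> P - B" "z \<in> P - B" "x < h" "h \<le> z" for x z
    using free_conf_outside[OF f assms(2), of x z] that assms(2) by (cases "x = 0") auto
  then have "crosses h True (P - B)" unfolding crosses_def by simp
  moreover have "crosses h \<sigma> (P - B)" using assms by (auto simp: side_def split: if_splits)
  ultimately show ?thesis
    using crosses_unique_large[of \<sigma> "P - B" True "P - B" "P - B"] conf_card[OF c] c by (auto simp: conf_def)
qed

lemma ex_side:
  assumes "conf P B" "B \<noteq> {}"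
  shows "\<exists>\<sigma>. side \<sigma> P B"
  using conf_crosses[OF assms] assms(2) by (auto simp: side_def)

end

section \<open>Structure of unicyclic graphs\<close>

locale unicyclic_graph = conn_graph V E for V :: "'a set" and E +
  fixes c :: "'a list"
  assumes cyc: "is_cycle V E c"
    and cyc_unique: "\<And>c'. is_cycle V E c' \<Longrightarrow> cycle_edges c' = cycle_edges c"
begin

lemma c_length: "3 \<le> length c" and c_distinct: "distinct c" and c_V: "set c \<subseteq> V"
  and c_edge: "i < length c \<Longrightarrow> E (c ! i) (c ! (Suc i mod length c))"
  using cyc by (auto simp: is_cycle_def)

text \<open>A shortest detour from \<open>u\<close> to \<open>v\<close> has no repeated vertex, so
  closing it with the edge \<open>{u, v}\<close> gives a second cycle.\<close>

lemma bridge: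
  assumes uv: "E u v" and "{u, v} \<notin> cycle_edges c"
  shows "\<not> (\<lambda>x y. E x y \<and> {x, y} \<noteq> {u, v})\<^sup>*\<^sup>* u v"
proof
  let ?F = "\<lambda>x y. E x y \<and> {x, y} \<noteq> {u, v}"
  assume "?F\<^sup>*\<^sup>* u v"
  then have ex: "\<exists>n. (?F ^^ n) u v" by (simp add: rtranclp_power)
  define n where "n = (LEAST n. (?F ^^ n) u v)"
  have n: "(?F ^^ n) u v" unfolding n_def using ex by (rule LeastI_ex)
  have n_min: "n \<le> m" if "(?F ^^ m) u v" for m unfolding n_def using that by (rule Least_le)
  from n obtain f where f: "f 0 = u" "f n = v" "\<forall>i<n. ?F (f i) (f (Suc i))"
    unfolding relpowp_fun_conv by blast
  have ne: "f i \<noteq> f j" if "i < j" "j \<le> n" for i j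
  proof
    assume eq: "f i = f j"
    have "(?F ^^ i) u (f i)" unfolding relpowp_fun_conv
      by (rule exI[of _ f]) (use f that in auto)
    moreover have "(?F ^^ (n - j)) (f i) v" unfolding relpowp_fun_conv
      by (rule exI[of _ "\<lambda>k. f (j + k)"]) (use f that eq in auto)
    ultimately have "(?F ^^ (i + (n - j))) u v" by (rule relpowp_add_intro)
    then have "n \<le> i + (n - j)" by (rule n_min)
    then show False using that by linarith
  qed
  have inj: "inj_on f {0..<Suc n}"
    by (rule inj_onI) (metis ne atLeastLessThan_iff less_Suc_eq_le linorder_neqE_nat)
  have "u \<noteq> v" using uv E_irrefl by blast
  then have "n \<noteq> 0" using f by auto
  \<comment> \<open>A detour of length one would be the forbidden edge itself.\<close>
  moreover have "n \<noteq> 1" using f by auto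
  ultimately have n2: "2 \<le> n" by linarith
  define p where "p = map f [0..<Suc n]"
  have lp: "length p = Suc n" by (simp add: p_def)
  have pn: "p ! i = f i" if "i \<le> n" for i using that by (simp add: p_def del: upt_Suc)
  have edge: "E (p ! i) (p ! (Suc i mod length p))" if "i < length p" for i
  proof (cases "i = n")
    case True
    then show ?thesis using pn[of n] pn[of 0] f uv E_sym lp by simp
  next
    case False
    then show ?thesis using pn[of i] pn[of "Suc i"] f that lp by simp
  qed
  have "distinct p" unfolding p_def using inj by (simp add: distinct_map del: upt_Suc)
  moreover have "set p \<subseteq> V" using edge E_in by (metis in_set_conv_nth subsetI)
  ultimately have "is_cycle V E p" using n2 lp edge unfolding is_cycle_def by simp
  then have eq: "cycle_edges p = cycle_edges c" by (rule cyc_unique)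
  have "{p ! n, p ! (Suc n mod length p)} \<in> cycle_edges p"
    unfolding cycle_edges_def mem_Collect_eq by (rule exI[of _ n]) (simp add: lp)
  moreover have "p ! n = v" "p ! (Suc n mod length p) = u" using pn[of n] pn[of 0] f lp by auto
  ultimately show False using eq assms(2) by (metis insert_commute)
qed

abbreviation C where "C \<equiv> set c"

lemma cycle_edges_in:
  assumes "{x, y} \<in> cycle_edges c"
  shows "x \<in> C \<and> y \<in> C"
proof -
  obtain i where "i < length c" "{x, y} = {c ! i, c ! (Suc i mod length c)}"
    using assms by (auto simp: cycle_edges_def)
  moreover have "Suc i mod length c < length c" using c_length by (intro mod_less_divisor) linarith
  ultimately have "{x, y} \<subseteq> C" by simp
  then show ?thesis by simp
qed

lemma cycle_reach:
  assumes "x \<in> C" "y \<in> C"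
  shows "(\<lambda>x y. E x y \<and> {x, y} \<in> cycle_edges c)\<^sup>*\<^sup>* x y"
proof -
  let ?R = "\<lambda>x y. E x y \<and> {x, y} \<in> cycle_edges c"
  have 0: "?R\<^sup>*\<^sup>* (c ! 0) (c ! i)" if "i < length c" for i
    using that
  proof (induction i)
    case (Suc i)
    then have "E (c ! i) (c ! Suc i)" using c_edge[of i] by simp
    moreover have "{c ! i, c ! (Suc i mod length c)} \<in> cycle_edges c"
      unfolding cycle_edges_def using Suc.prems Suc_lessD by blast
    ultimately have "?R (c ! i) (c ! Suc i)" using Suc.prems by simp
    moreover have "?R\<^sup>*\<^sup>* (c ! 0) (c ! i)" using Suc by simp
    ultimately show ?case by (rule rtranclp.rtrancl_into_rtrancl[rotated])
  qed simp
  have "symp ?R" by (rule sympI) (auto simp: E_sym insert_commute)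
  then have "symp ?R\<^sup>*\<^sup>*" by (rule symp_rtranclp)
  then have sym: "?R\<^sup>*\<^sup>* b a" if "?R\<^sup>*\<^sup>* a b" for a b using that by (rule sympD)
  obtain i j where "i < length c" "c ! i = x" "j < length c" "c ! j = y"
    using assms unfolding in_set_conv_nth by blast
  then have "?R\<^sup>*\<^sup>* x (c ! 0)" "?R\<^sup>*\<^sup>* (c ! 0) y" using 0[of i] 0[of j] sym by auto
  then show ?thesis by (rule rtranclp_trans)
qed

text \<open>The ends of a chord remain joined along the cycle, contrary to
  \<open>bridge\<close>.\<close>

lemma no_chord:
  assumes "E u v" "u \<in> C" "v \<in> C"
  shows "{u, v} \<in> cycle_edges c"
proof (rule ccontr)
  assume no: "{u, v} \<notin> cycle_edges c"
  have "(\<lambda>x y. E x y \<and> {x, y} \<noteq> {u, v})\<^sup>*\<^sup>* u v"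
    by (rule mono_rtranclp[rule_format, OF _ cycle_reach[OF assms(2,3)]]) (use no in auto)
  then show False using bridge[OF assms(1) no] by blast
qed

section \<open>Depth, parents and projection to the cycle\<close>

definition depth :: "'a \<Rightarrow> nat" where
  "depth v = (LEAST n. \<exists>y\<in>C. (E ^^ n) v y)"

lemma depth_relpowp:
  assumes "v \<in> V"
  shows "\<exists>y\<in>C. (E ^^ depth v) v y"
proof -
  have "c ! 0 \<in> C" using c_length by (intro nth_mem) linarith
  then have "\<exists>n. \<exists>y\<in>C. (E ^^ n) v y" using connected_relpowp[OF assms] c_V by blast
  then show ?thesis unfolding depth_def by (rule LeastI_ex)
qed

lemma depth_le: "(E ^^ n) v y \<Longrightarrow> y \<in> C \<Longrightarrow> depth v \<le> n"
  unfolding depth_def by (rule Least_le) blast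

lemma depth_eq_0: "v \<in> V \<Longrightarrow> depth v = 0 \<longleftrightarrow> v \<in> C"
  using depth_relpowp[of v] depth_le[of 0 v v] by auto

lemma depth_edge:
  assumes "E u v"
  shows "depth u \<le> Suc (depth v)"
proof -
  obtain y where "y \<in> C" "(E ^^ depth v) v y" using depth_relpowp E_in assms by blast
  then show ?thesis using depth_le[of "Suc (depth v)" u y] relpowp_Suc_I2 assms by metis
qed

lemma ex_parent:
  assumes "v \<in> V" "v \<notin> C"
  shows "\<exists>p. E v p \<and> Suc (depth p) = depth v"
proof -
  obtain y where y: "y \<in> C" "(E ^^ depth v) v y" using depth_relpowp assms by blast
  obtain d where d: "depth v = Suc d" using depth_eq_0 assms by (cases "depth v") auto
  then obtain p where p: "E v p" "(E ^^ d) p y" using y by (metis relpowp_Suc_D2)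
  then have "depth p \<le> d" using y depth_le by blast
  then show ?thesis using depth_edge[OF p(1)] d p by (intro exI[of _ p]) auto
qed

lemma reach_cycle_avoiding:
  assumes "v \<notin> C" "p \<in> V" "p \<noteq> v" "depth p \<le> depth v"
  shows "\<exists>y\<in>C. (\<lambda>x y. E x y \<and> x \<noteq> v \<and> y \<noteq> v)\<^sup>*\<^sup>* p y"
  using assms(2-)
proof (induction "depth p" arbitrary: p rule: less_induct)
  case less
  show ?case
  proof (cases "p \<in> C")
    case True then show ?thesis by blast
  next
    case False
    then obtain q where q: "E p q" "Suc (depth q) = depth p" using ex_parent less.prems by blast
    then have "q \<noteq> v" "q \<in> V" using less.prems E_in by auto
    then obtain y where "y \<in> C" "(\<lambda>x y. E x y \<and> x \<noteq> v \<and> y \<noteq> v)\<^sup>*\<^sup>* q y"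
      using less.hyps[of q] q less.prems by auto
    moreover have "E p q \<and> p \<noteq> v \<and> q \<noteq> v" using q \<open>q \<noteq> v\<close> less.prems by blast
    ultimately show ?thesis
      using converse_rtranclp_into_rtranclp[of "\<lambda>x y. E x y \<and> x \<noteq> v \<and> y \<noteq> v" p q] by blast
  qed
qed

text \<open>Both neighbours reach the cycle without \<open>v\<close>, hence each other, so the edge
  from \<open>p\<close> to \<open>v\<close> would not be a bridge. Allowing equal depth also
  excludes edges within a level.\<close>

lemma parent_unique:
  assumes "v \<notin> C" "E v p" "E v p'" "depth p \<le> depth v" "depth p' \<le> depth v"
  shows "p = p'"
proof (rule ccontr)
  assume ne: "p \<noteq> p'"
  let ?A = "\<lambda>x y. E x y \<and> x \<noteq> v \<and> y \<noteq> v"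
  let ?F = "\<lambda>x y. E x y \<and> {x, y} \<noteq> {p, v}"
  have pv: "p \<noteq> v" "p' \<noteq> v" "p \<in> V" "p' \<in> V" using assms E_irrefl E_in by blast+
  obtain y y' where y: "y \<in> C" "?A\<^sup>*\<^sup>* p y" "y' \<in> C" "?A\<^sup>*\<^sup>* p' y'"
    using reach_cycle_avoiding[OF assms(1) pv(3,1) assms(4)]
      reach_cycle_avoiding[OF assms(1) pv(4,2) assms(5)] by blast
  have "?A\<^sup>*\<^sup>* y y'"
    by (rule mono_rtranclp[rule_format, OF _ cycle_reach[OF y(1,3)]])
      (use assms(1) cycle_edges_in in blast)
  moreover have "symp ?A" by (rule sympI) (auto simp: E_sym)
  then have "symp ?A\<^sup>*\<^sup>*" by (rule symp_rtranclp)
  then have "?A\<^sup>*\<^sup>* y' p'" using y(4) by (rule sympD)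
  ultimately have "?A\<^sup>*\<^sup>* y p'" by (rule rtranclp_trans)
  with y(2) have "?A\<^sup>*\<^sup>* p p'" by (rule rtranclp_trans)
  then have "?F\<^sup>*\<^sup>* p p'"
    by (rule mono_rtranclp[rule_format, rotated]) (auto simp: doubleton_eq_iff)
  moreover have "?F p' v" using assms(3) E_sym ne pv by (auto simp: doubleton_eq_iff)
  ultimately have "?F\<^sup>*\<^sup>* p v" by (rule rtranclp.rtrancl_into_rtrancl)
  moreover have "{p, v} \<notin> cycle_edges c" using cycle_edges_in assms(1) by blast
  ultimately show False using bridge[of p v] assms(2) E_sym by blast
qed

text \<open>Cycle vertices are fixed points, so iterating from any vertex stops at the root of its
  tree.\<close>

definition par :: "'a \<Rightarrow> 'a" where
  "par v = (if v \<in> C then v else SOME p. E v p \<and> Suc (depth p) = depth v)"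

lemma par_cycle [simp]: "v \<in> C \<Longrightarrow> par v = v"
  by (simp add: par_def)

lemma par_edge:
  assumes "v \<in> V" "v \<notin> C"
  shows "E v (par v)" "depth v = Suc (depth (par v))"
  using someI_ex[OF ex_parent[OF assms]] assms(2) by (auto simp: par_def)

lemma par_V: "v \<in> V \<Longrightarrow> par v \<in> V"
  using par_edge E_in by (cases "v \<in> C") auto

text \<open>Unless both ends are on the cycle, the deeper end is off it and
  \<open>parent_unique\<close> identifies the other end. Moves and distances are analysed through
  these three kinds of edges.\<close>

lemma edge_cases:
  assumes "E u v"
  obtains (cycle) "u \<in> C" "v \<in> C" "{u, v} \<in> cycle_edges c"
    | (up) "u \<notin> C" "v = par u" | (down) "v \<notin> C" "u = par v"
proof -
  have uv: "u \<in> V" "v \<in> V" using assms E_in by auto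
  consider "u \<in> C" "v \<in> C" | "u \<notin> C" "depth v \<le> depth u" | "v \<notin> C" "depth u \<le> depth v"
    using depth_eq_0 uv by (metis le_zero_eq linorder_linear)
  then show ?thesis
  proof cases
    case 1 then show ?thesis using no_chord assms cycle by blast
  next
    case 2
    then show ?thesis using parent_unique[OF 2(1) assms par_edge(1)] par_edge(2)[of u] uv up by simp
  next
    case 3
    then show ?thesis using parent_unique[OF 3(1) E_sym[OF assms] par_edge(1)] par_edge(2)[of v] uv down by simp
  qed
qed

definition proj :: "'a \<Rightarrow> 'a" where
  "proj v = (par ^^ depth v) v"

lemma proj_cycle [simp]: "v \<in> C \<Longrightarrow> proj v = v"
  using depth_eq_0[of v] c_V by (auto simp: proj_def)

lemma proj_par: "v \<in> V \<Longrightarrow> proj (par v) = proj v"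
  using par_edge(2)[of v] by (cases "v \<in> C") (auto simp: proj_def funpow_swap1)

lemma depth_induct [consumes 1, case_names cycle par]:
  assumes "v \<in> V" "\<And>v. v \<in> C \<Longrightarrow> Q v"
    "\<And>v. v \<in> V \<Longrightarrow> v \<notin> C \<Longrightarrow> Q (par v) \<Longrightarrow> Q v"
  shows "Q v"
  using assms(1)
proof (induction "depth v" arbitrary: v rule: less_induct)
  case less
  then show ?case using assms(2,3) par_edge(2)[of v] par_V[of v] by (cases "v \<in> C") auto
qed

lemma proj_in: "v \<in> V \<Longrightarrow> proj v \<in> C"
  by (induction rule: depth_induct) (auto simp: proj_par)

lemma proj_relpowp: "v \<in> V \<Longrightarrow> (E ^^ depth v) v (proj v)"
proof (induction rule: depth_induct)
  case (cycle v)
  then show ?case using depth_eq_0[of v] c_V by auto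
next
  case (par v)
  then have "(E ^^ Suc (depth (par v))) v (proj v)"
    using par_edge(1)[of v] proj_par[of v] by (intro relpowp_Suc_I2[of E v "par v"]) auto
  then show ?case using par_edge(2)[of v] par by simp
qed

lemma proj_root:
  assumes "v \<in> V" "v \<notin> C"
  shows "\<exists>w\<in>V - C. E (proj v) w"
  using assms
proof (induction rule: depth_induct)
  case (par v)
  show ?case
  proof (cases "par v \<in> C")
    case True
    then have "proj v = par v" using proj_par[of v] par.hyps by simp
    then show ?thesis using par par_edge(1)[of v] E_sym by auto
  next
    case False
    then show ?thesis using par proj_par[of v] by simp
  qed
qed simp

text \<open>The root has two cycle neighbours and one in its tree. Hence robots off the cycle
  project to attachment vertices.\<close>

lemma degree_proj:
  assumes "v \<in> V" "v \<notin> C"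
  shows "3 \<le> degree V E (proj v)"
proof -
  obtain w where w: "w \<in> V" "w \<notin> C" "E (proj v) w" using proj_root assms by blast
  obtain i where i: "i < length c" "c ! i = proj v" using proj_in assms by (metis in_set_conv_nth)
  let ?n = "length c"
  \<comment> \<open>The cyclic predecessor of \<open>i\<close>; it differs from the successor
    because the cycle has length at least 3.\<close>
  define j where "j = (if i = 0 then ?n - 1 else i - 1)"
  have j: "j < ?n" "Suc j mod ?n = i" "j \<noteq> Suc i mod ?n" "Suc i mod ?n < ?n"
    using i(1) c_length by (auto simp: j_def mod_Suc)
  have e: "E (proj v) (c ! (Suc i mod ?n))" "E (proj v) (c ! j)"
    using c_edge[OF i(1)] c_edge[OF j(1)] i j E_sym by auto
  have "c ! j \<noteq> c ! (Suc i mod ?n)" using j c_distinct by (simp add: nth_eq_iff_index_eq)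
  moreover have "c ! j \<in> C" "c ! (Suc i mod ?n) \<in> C" using j by auto
  ultimately have "card {w, c ! j, c ! (Suc i mod ?n)} = 3" using w(2) by (auto simp: card_insert_if)
  moreover have "card {w, c ! j, c ! (Suc i mod ?n)} \<le> degree V E (proj v)"
    unfolding degree_def using finite_V e w E_in by (intro card_mono) auto
  ultimately show ?thesis by simp
qed

end

section \<open>Subtrees, distinct projections and distances via the cycle\<close>

context unicyclic_graph
begin

text \<open>The subtree below \<open>m\<close>; for \<open>m\<close> on the cycle, the whole tree
  rooted there.\<close>

definition desc :: "'a \<Rightarrow> 'a set" where
  "desc m = {v \<in> V. \<exists>i. (par ^^ i) v = m}"

lemma desc_V: "v \<in> desc m \<Longrightarrow> v \<in> V"
  by (simp add: desc_def)

lemma desc_self: "m \<in> V \<Longrightarrow> m \<in> desc m"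
  by (auto simp: desc_def intro: exI[of _ 0])

lemma funpow_par_cycle: "v \<in> C \<Longrightarrow> (par ^^ i) v = v"
  by (induction i) auto

lemma desc_par:
  assumes "v \<in> desc m" "v \<noteq> m"
  shows "v \<notin> C" "par v \<in> desc m"
proof -
  obtain i where i: "(par ^^ i) v = m" "v \<in> V" using assms by (auto simp: desc_def)
  then show "v \<notin> C" using funpow_par_cycle[of v i] assms(2) by auto
  obtain j where "i = Suc j" using i assms(2) by (cases i) auto
  then have "(par ^^ j) (par v) = m" using i by (simp add: funpow_swap1)
  then show "par v \<in> desc m" using i par_V by (auto simp: desc_def)
qed

lemma desc_child:
  assumes "par v \<in> desc m" "v \<in> V"
  shows "v \<in> desc m"
proof -
  obtain i where "(par ^^ i) (par v) = m" using assms by (auto simp: desc_def)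
  then have "(par ^^ Suc i) v = m" by (simp add: funpow_swap1)
  then show ?thesis using assms(2) unfolding desc_def by blast
qed

lemma desc_depth:
  assumes "v \<in> desc m"
  shows "depth m \<le> depth v"
proof -
  have "v \<in> V" using assms by (rule desc_V)
  then show ?thesis using assms
  proof (induction rule: depth_induct)
    case (cycle v)
    then show ?case using desc_par(1)[of v m] by auto
  next
    case (par v)
    then show ?case using desc_par(2)[of v m] par_edge(2)[of v] by (cases "v = m") auto
  qed
qed

lemma closed_off_desc:
  assumes "n \<in> V" "n \<notin> C"
  shows "closed_off (par n) (desc n)"
  unfolding closed_off_def
proof (intro conjI allI impI)
  show "par n \<notin> desc n" using desc_depth[of "par n" n] par_edge(2)[OF assms] by auto
  fix u v assume u: "u \<in> desc n" and e: "E u v"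
  from e show "v \<in> desc n \<or> v = par n"
  proof (cases rule: edge_cases)
    case cycle
    then show ?thesis using desc_par(1)[OF u] assms by blast
  next
    case up
    then show ?thesis using desc_par(2)[OF u] by auto
  next
    case down
    then show ?thesis using desc_child[of v n] u e E_in by auto
  qed
qed

text \<open>Two ancestors of one vertex are comparable, and depth strictly decreases towards the
  cycle.\<close>

lemma desc_disjoint:
  assumes "depth n = depth n'" "n \<noteq> n'" "n \<in> V" "n' \<in> V"
  shows "desc n \<inter> desc n' = {}"
proof (rule ccontr)
  assume "desc n \<inter> desc n' \<noteq> {}"
  then obtain v i j where v: "v \<in> V" "(par ^^ i) v = n" "(par ^^ j) v = n'" by (auto simp: desc_def)
  have *: False if "(par ^^ i) v = x" "(par ^^ j) v = y" "i \<le> j" "x \<noteq> y" "depth x = depth y" "x \<in> V"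
    for i j x y
  proof -
    have "(par ^^ (j - i)) x = y"
      using that by (metis funpow_add comp_apply le_add_diff_inverse2)
    then have "x \<in> desc y" using that by (auto simp: desc_def)
    then show False using desc_par[of x y] desc_depth[of "par x" y] par_edge(2)[of x] that by auto
  qed
  show False
    using *[of i n j n'] *[of j n' i n] v assms by (metis nat_le_linear)
qed

lemma desc_branch:
  assumes "a \<in> desc m" "a \<noteq> m"
  shows "\<exists>n\<in>V. n \<notin> C \<and> par n = m \<and> a \<in> desc n"
proof -
  have "a \<in> V" using assms(1) by (rule desc_V)
  then show ?thesis using assms
  proof (induction rule: depth_induct)
    case (cycle v)
    then show ?case using desc_par(1) by blast
  next
    case (par v)
    show ?case
    proof (cases "par v = m")
      case True
      then show ?thesis using par desc_self by blast
    next
      case False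
      then obtain n where "n \<in> V" "n \<notin> C" "par n = m" "par v \<in> desc n"
        using par desc_par(2)[of v m] by blast
      then show ?thesis using desc_child par by blast
    qed
  qed
qed

lemma desc_proj: "v \<in> V \<Longrightarrow> v \<in> desc (proj v)"
  by (auto simp: desc_def proj_def)

text \<open>Take \<open>m\<close> as deep as possible with two robots in \<open>desc m\<close>. Each
  branch below \<open>m\<close> then holds at most one robot, so two branches and a third robot
  elsewhere form the tripod.\<close>

lemma ex_tripod:
  assumes gp: "gp_set V E S" and card: "3 \<le> card S"
    and ab: "a \<in> S" "b \<in> S" "a \<noteq> b" "proj a = proj b"
  shows "\<exists>m\<in>V. \<exists>X Y. closed_off m X \<and> closed_off m Y \<and> X \<inter> Y = {} \<and> tripod m X Y S"
proof -
  have SV: "S \<subseteq> V" using gp by (simp add: gp_set_def)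
  define Q where "Q m \<longleftrightarrow> m \<in> V \<and> (\<exists>a b. a \<in> S \<inter> desc m \<and> b \<in> S \<inter> desc m \<and> a \<noteq> b)" for m
  have "Q (proj a)"
  proof -
    have "a \<in> desc (proj a)" "b \<in> desc (proj a)" using desc_proj[of a] desc_proj[of b] ab SV by auto
    moreover have "proj a \<in> V" using proj_in[of a] c_V ab SV by auto
    ultimately show ?thesis using ab unfolding Q_def by blast
  qed
  moreover have "\<forall>m. Q m \<longrightarrow> depth m < Suc (Max (depth ` V))"
    using finite_V by (auto simp: Q_def less_Suc_eq_le)
  ultimately obtain m where m: "Q m" "\<And>n. Q n \<Longrightarrow> depth n \<le> depth m"
    using ex_has_greatest_nat[of Q "proj a" depth] by blast
  have few: "x = y" if "n \<in> V" "n \<notin> C" "par n = m" "x \<in> S \<inter> desc n" "y \<in> S \<inter> desc n" for n x y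
    using m(2)[of n] par_edge(2)[of n] that unfolding Q_def by auto
  obtain a b where ab: "a \<in> S" "a \<in> desc m" "b \<in> S" "b \<in> desc m" "a \<noteq> b" and mV: "m \<in> V"
    using m(1) unfolding Q_def by blast
  have third: "\<exists>d\<in>S. d \<noteq> x \<and> d \<noteq> y" for x y
  proof (rule ccontr)
    assume "\<not> ?thesis"
    then have "S \<subseteq> {x, y}" by blast
    then have "card S \<le> card {x, y}" by (intro card_mono) auto
    also have "\<dots> \<le> 2" by (simp add: card_insert_if)
    finally show False using card by simp
  qed
  \<comment> \<open>A robot on \<open>m\<close> would separate the single robot \<open>x\<close> of
    some branch from any third robot.\<close>
  have mS: "m \<notin> S"
  proof -
    obtain x where x: "x \<in> S" "x \<in> desc m" "x \<noteq> m" using ab by metis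
    then obtain n where n: "n \<in> V" "n \<notin> C" "par n = m" "x \<in> desc n" using desc_branch by blast
    obtain d where d: "d \<in> S" "d \<noteq> x" "d \<noteq> m" using third by blast
    then have "d \<notin> desc n" using few n x by blast
    then show ?thesis
      using gp_set_separated[OF gp closed_off_desc[OF n(1,2)], of x d] n x d by auto
  qed
  then have "a \<noteq> m" "b \<noteq> m" using ab by auto
  then obtain n n' where n: "n \<in> V" "n \<notin> C" "par n = m" "a \<in> desc n"
    and n': "n' \<in> V" "n' \<notin> C" "par n' = m" "b \<in> desc n'" using desc_branch ab by meson
  obtain d where d: "d \<in> S" "d \<noteq> a" "d \<noteq> b" using third by blast
  have "n \<noteq> n'" using few[of n a b] n n' ab by auto
  then have "desc n \<inter> desc n' = {}"
    using desc_disjoint[of n n'] par_edge(2)[of n] par_edge(2)[of n'] n n' by simp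
  moreover have "d \<notin> desc n" "d \<notin> desc n'" using few[of n a d] few[of n' b d] n n' ab d by auto
  then have "tripod m (desc n) (desc n') S"
    using ab n n' d mS unfolding tripod_def by blast
  moreover have "closed_off m (desc n)" "closed_off m (desc n')"
    using closed_off_desc[OF n(1,2)] closed_off_desc[OF n'(1,2)] n(3) n'(3) by simp_all
  ultimately show ?thesis using mV by blast
qed

text \<open>Two robots with equal projection give a tripod, which persists in both directions of
  time, so its centre is never visited.\<close>

lemma mobile_inj_on_proj:
  assumes step: "\<And>i. i < M \<Longrightarrow> step (seq i) (seq (Suc i))"
    and gp: "\<And>i. i \<le> M \<Longrightarrow> gp_set V E (seq i)" and cover: "(\<Union>i\<le>M. seq i) = V"
    and i: "i \<le> M" "3 \<le> card (seq i)"
  shows "inj_on proj (seq i)"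
proof (rule ccontr)
  assume "\<not> ?thesis"
  then obtain a b where "a \<in> seq i" "b \<in> seq i" "a \<noteq> b" "proj a = proj b" by (auto simp: inj_on_def)
  then obtain m X Y where m: "m \<in> V" and XY: "closed_off m X" "closed_off m Y" "X \<inter> Y = {}"
    and t: "tripod m X Y (seq i)" using ex_tripod[OF gp[OF i(1)] i(2)] by blast
  have eq: "tripod m X Y (seq j) \<longleftrightarrow> tripod m X Y (seq 0)" if "j \<le> M" for j
    using that
  proof (induction j)
    case (Suc j)
    then have "step (seq j) (seq (Suc j))" using step by simp
    then have "tripod m X Y (seq j) \<longleftrightarrow> tripod m X Y (seq (Suc j))"
      using tripod_step[OF _ XY] step_sym by blast
    then show ?case using Suc by simp
  qed simp
  have "m \<notin> seq j" if "j \<le> M" for j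
  proof -
    have "tripod m X Y (seq j)" using eq[OF that] eq[OF i(1)] t by simp
    then show ?thesis using tripod_not_mem[OF gp[OF that] XY(1)] XY(3) by blast
  qed
  then show False using m cover by blast
qed

subsection \<open>Positions on the cycle\<close>

definition pos :: "'a \<Rightarrow> nat" where
  "pos v = (SOME i. i < length c \<and> c ! i = proj v)"

lemma pos_props:
  assumes "v \<in> V"
  shows "pos v < length c" "c ! pos v = proj v"
proof -
  have "\<exists>i. i < length c \<and> c ! i = proj v" using proj_in[OF assms] by (simp add: in_set_conv_nth)
  from someI_ex[OF this] show "pos v < length c" "c ! pos v = proj v" by (auto simp: pos_def)
qed

lemma pos_nth: "i < length c \<Longrightarrow> pos (c ! i) = i"
  using pos_props[of "c ! i"] subsetD[OF c_V nth_mem[of i c]] c_distinct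
  by (simp add: nth_eq_iff_index_eq)

lemma pos_par: "v \<in> V \<Longrightarrow> pos (par v) = pos v"
  by (simp add: pos_def proj_par)

lemma pos_edge:
  assumes "E u v"
  shows "pos u = pos v \<or> u \<in> C \<and> v \<in> C \<and> \<bar>int (pos u) - int (pos v)\<bar> \<in> {1, int (length c) - 1}"
  using assms
proof (cases rule: edge_cases)
  case cycle
  then obtain i where i: "i < length c" "{u, v} = {c ! i, c ! (Suc i mod length c)}"
    by (auto simp: cycle_edges_def)
  have j: "Suc i mod length c < length c" using c_length by (intro mod_less_divisor) linarith
  have "{pos u, pos v} = pos ` {u, v}" by simp
  also have "\<dots> = {i, Suc i mod length c}" unfolding i(2) using i j by (simp add: pos_nth)
  finally have "pos u = i \<and> pos v = Suc i mod length c \<or> pos v = i \<and> pos u = Suc i mod length c"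
    by (auto simp: doubleton_eq_iff)
  moreover have "Suc i mod length c = (if Suc i = length c then 0 else Suc i)"
    using i by (auto simp: mod_Suc)
  ultimately show ?thesis using cycle i(1) by (auto split: if_splits)
next
  case up
  then show ?thesis using pos_par[of u] assms E_in by auto
next
  case down
  then show ?thesis using pos_par[of v] assms E_in by auto
qed

lemma arc_direct:
  assumes "i \<le> j" "j < length c"
  shows "(E ^^ (j - i)) (c ! i) (c ! j)"
  unfolding relpowp_fun_conv
proof (rule exI[of _ "\<lambda>k. c ! (i + k)"], intro conjI allI impI)
  fix k assume "k < j - i"
  then show "E (c ! (i + k)) (c ! (i + Suc k))" using c_edge[of "i + k"] assms by simp
qed (use assms in auto)

lemma arc_wrap:
  assumes "i \<le> j" "j < length c"
  shows "(E ^^ (length c - (j - i))) (c ! i) (c ! j)"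
proof -
  let ?n = "length c"
  have a: "(E ^^ i) (c ! i) (c ! 0)"
    using relpowp_sym[OF E_sym arc_direct[of 0 i]] assms by simp
  have b: "(E ^^ (?n - 1 - j)) (c ! (?n - 1)) (c ! j)"
    using relpowp_sym[OF E_sym arc_direct[of j "?n - 1"]] assms by simp
  have "Suc (?n - 1) = ?n" using c_length by linarith
  then have "E (c ! (?n - 1)) (c ! 0)" using c_edge[of "?n - 1"] by simp
  then have "E (c ! 0) (c ! (?n - 1))" by (rule E_sym)
  then have "(E ^^ 1) (c ! 0) (c ! (?n - 1))" by (simp only: relpowp_1)
  from relpowp_add_intro[OF relpowp_add_intro[OF a this] b]
  have "(E ^^ (i + 1 + (?n - 1 - j))) (c ! i) (c ! j)" .
  moreover have "i + 1 + (?n - 1 - j) = ?n - (j - i)" using assms by linarith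
  ultimately show ?thesis by (simp only:)
qed

definition cdist :: "nat \<Rightarrow> nat \<Rightarrow> int" where
  "cdist i j = min \<bar>int i - int j\<bar> (int (length c) - \<bar>int i - int j\<bar>)"

text \<open>The potential \<open>\<phi>\<close> is minus the depth in the tree of \<open>a\<close>,
  the cycle distance from \<open>a\<close> elsewhere, with the depth added in the tree of
  \<open>d\<close>. Its growth from \<open>a\<close> to \<open>d\<close> is the claimed
  bound.\<close>

lemma gdist_ge:
  assumes a: "a \<in> V" and d: "d \<in> V" and ne: "pos a \<noteq> pos d"
  shows "int (depth a) + cdist (pos a) (pos d) + int (depth d) \<le> int (gdist E a d)"
proof -
  define \<phi> where "\<phi> v = cdist (pos a) (pos v) +
    (if pos v = pos d then int (depth v) else if pos v = pos a then - int (depth v) else 0)" for v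
  have *: "min \<bar>x - q\<bar> (l - \<bar>x - q\<bar>) \<le> min \<bar>x - p\<bar> (l - \<bar>x - p\<bar>) + 1"
    if "\<bar>p - q\<bar> = 1 \<or> \<bar>p - q\<bar> = l - 1" "0 \<le> x" "x < l" "0 \<le> p" "p < l" "0 \<le> q" "q < l"
    for x p q l :: int
    using that by (auto simp: min_def abs_if split: if_splits)
  have lip: "\<phi> v \<le> \<phi> u + 1" if e: "E u v" for u v
  proof -
    have uv: "u \<in> V" "v \<in> V" using E_in e by auto
    from pos_edge[OF e] show ?thesis
    proof
      assume "pos u = pos v"
      then show ?thesis using depth_edge[OF e] depth_edge[OF E_sym[OF e]] by (auto simp: \<phi>_def)
    next
      assume A: "u \<in> C \<and> v \<in> C \<and> \<bar>int (pos u) - int (pos v)\<bar> \<in> {1, int (length c) - 1}"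
      have "depth u = 0" "depth v = 0" using A depth_eq_0 uv by auto
      then have "\<phi> u = cdist (pos a) (pos u)" "\<phi> v = cdist (pos a) (pos v)" by (simp_all add: \<phi>_def)
      moreover have "cdist (pos a) (pos v) \<le> cdist (pos a) (pos u) + 1"
        unfolding cdist_def using A pos_props(1)[OF uv(1)] pos_props(1)[OF uv(2)] pos_props(1)[OF a]
        by (intro *) auto
      ultimately show ?thesis by simp
    qed
  qed
  obtain n where "(E ^^ n) a d" using connected_relpowp[OF a d] by blast
  then have "(E ^^ gdist E a d) a d" by (rule gdist_relpowp)
  then have "\<phi> d \<le> \<phi> a + int (gdist E a d)" using relpowp_lipschitz[of E \<phi>] lip by blast
  moreover have "cdist (pos a) (pos a) = 0" by (simp add: cdist_def)
  ultimately show ?thesis using ne by (simp add: \<phi>_def)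
qed

lemma relpowp_via_cycle:
  assumes "a \<in> V" "d \<in> V" "(E ^^ n) (c ! pos a) (c ! pos d)"
  shows "(E ^^ (depth a + n + depth d)) a d"
proof -
  have a: "(E ^^ depth a) a (c ! pos a)" and d: "(E ^^ depth d) d (c ! pos d)"
    using proj_relpowp pos_props assms by auto
  show ?thesis
    by (rule relpowp_add_intro[OF relpowp_add_intro[OF a assms(3)] relpowp_sym[OF E_sym d]])
qed

text \<open>The vertex \<open>b\<close> lies on a shortest arc between the roots of \<open>a\<close>
  and \<open>d\<close>. The inequalities are not strict because for antipodal roots either arc is
  shortest.\<close>

lemma between_collinear:
  assumes V: "a \<in> V" "d \<in> V" and b: "b \<in> C" and lt: "pos a < pos d"
    and btw: "pos a < pos b \<and> pos b < pos d \<and> 2 * (pos d - pos a) \<le> length c \<or>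
      (pos b < pos a \<or> pos d < pos b) \<and> length c \<le> 2 * (pos d - pos a)"
  shows "\<exists>p. shortest_path E p \<and> a \<in> set p \<and> b \<in> set p \<and> d \<in> set p"
proof -
  have bV: "b \<in> V" and db: "depth b = 0" using b c_V depth_eq_0 by auto
  note lts = pos_props(1)[OF V(1)] pos_props(1)[OF V(2)] pos_props(1)[OF bV]
  have "\<exists>m n. (E ^^ m) (c ! pos a) (c ! pos b) \<and> (E ^^ n) (c ! pos b) (c ! pos d) \<and>
      int m + int n = cdist (pos a) (pos d)"
  proof -
    consider "pos a < pos b" "pos b < pos d" "2 * (pos d - pos a) \<le> length c"
      | "pos b < pos a" "length c \<le> 2 * (pos d - pos a)"
      | "pos d < pos b" "length c \<le> 2 * (pos d - pos a)" using btw by blast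
    then show ?thesis
    proof cases
      case 1
      then show ?thesis using arc_direct[of "pos a" "pos b"] arc_direct[of "pos b" "pos d"] lts
        by (intro exI[of _ "pos b - pos a"] exI[of _ "pos d - pos b"]) (auto simp: cdist_def)
    next
      case 2
      then show ?thesis
        using relpowp_sym[OF E_sym arc_direct[of "pos b" "pos a"]] arc_wrap[of "pos b" "pos d"] lts lt
        by (intro exI[of _ "pos a - pos b"] exI[of _ "length c - (pos d - pos b)"]) (auto simp: cdist_def)
    next
      case 3
      then show ?thesis
        using arc_wrap[of "pos a" "pos b"] relpowp_sym[OF E_sym arc_direct[of "pos d" "pos b"]] lts lt
        by (intro exI[of _ "length c - (pos b - pos a)"] exI[of _ "pos b - pos d"]) (auto simp: cdist_def)
    qed
  qed
  then obtain m n where mn: "(E ^^ m) (c ! pos a) (c ! pos b)" "(E ^^ n) (c ! pos b) (c ! pos d)"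
    "int m + int n = cdist (pos a) (pos d)" by blast
  have "(depth a + m + depth b) + (depth b + n + depth d) \<le> gdist E a d"
    using gdist_ge[OF V] lt mn(3) db by simp
  then show ?thesis
    using shortest_path_through[OF relpowp_via_cycle[OF V(1) bV mn(1)] relpowp_via_cycle[OF bV V(2) mn(2)]]
    by blast
qed

lemma gp_set_free_conf:
  assumes gp: "gp_set V E S" and len: "length c = 2 * h"
  shows "free_conf h (pos ` S) (pos ` (S \<inter> C))"
proof -
  have SV: "S \<subseteq> V" using gp by (simp add: gp_set_def)
  have "(pos a < pos b \<and> pos b < pos d \<longrightarrow> pos a + h < pos d) \<and>
      (pos b < pos a \<or> pos d < pos b \<longrightarrow> pos d < pos a + h)"
    if "b \<in> S" "b \<in> C" "a \<in> S" "d \<in> S" "pos a \<noteq> pos b" "pos d \<noteq> pos b" "pos a < pos d" for a b d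
  proof (rule ccontr)
    assume "\<not> ?thesis"
    then have "\<exists>p. shortest_path E p \<and> a \<in> set p \<and> b \<in> set p \<and> d \<in> set p"
      using that SV len by (intro between_collinear) auto
    moreover have "a \<noteq> b" "d \<noteq> b" "a \<noteq> d" using that by auto
    ultimately show False using gp_set_not_collinear[OF gp, of a b d] that by blast
  qed
  moreover have "pos ` S \<subseteq> {..<2 * h}" using pos_props(1) SV len by auto
  ultimately show ?thesis unfolding free_conf_def by auto
qed

end

section \<open>The upper bound\<close>

context unicyclic_graph
begin

lemma mobile_card_le:
  assumes len: "length c = 2 * h"
    and marking: "balanced_marking h \<kappa> {i. i < 2 * h \<and> 3 \<le> degree V E (c ! i)}"
    and mob: "mobile_gp_set V E S"
  shows "card S \<le> \<kappa> + 2"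
proof (rule ccontr)
  assume large: "\<not> ?thesis"
  define R where "R = {i. i < 2 * h \<and> 3 \<le> degree V E (c ! i)}"
  interpret balanced_marking h \<kappa> R using marking by (simp add: R_def)
  obtain seq M where s0: "seq (0::nat) = S" and st: "\<And>i. i < M \<Longrightarrow> step (seq i) (seq (Suc i))"
    and gp: "\<And>i. i \<le> M \<Longrightarrow> gp_set V E (seq i)" and cover: "(\<Union>i\<le>M. seq i) = V"
    using mobile_gp_setE[OF mob] by blast
  have card: "card (seq i) = card S" if "i \<le> M" for i
    using that
  proof (induction i)
    case (Suc i)
    then show ?case using step_card[OF st[of i]] by simp
  qed (simp add: s0)
  define P where "P T = pos ` T" for T
  define B where "B T = pos ` (T \<inter> C)" for T
  have inj: "inj_on pos (seq i)" if i: "i \<le> M" for i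
  proof -
    have "inj_on proj (seq i)"
      using mobile_inj_on_proj[OF st gp cover i] card[OF i] large kappa_pos by linarith
    moreover have "seq i \<subseteq> V" using gp[OF i] by (simp add: gp_set_def)
    ultimately show ?thesis using pos_props(2) unfolding inj_on_def by (metis subsetD)
  qed
  \<comment> \<open>Distinct projections matter here: otherwise a robot off the cycle could hide
    behind one standing at its root.\<close>
  have PB: "P (seq i) - B (seq i) = pos ` (seq i - C)" if "i \<le> M" for i
    using inj[OF that] unfolding P_def B_def inj_on_def by blast
  have conf: "conf (P (seq i)) (B (seq i))" if i: "i \<le> M" for i
  proof -
    have V: "seq i \<subseteq> V" using gp[OF i] by (simp add: gp_set_def)
    have "pos v \<in> R" if "v \<in> seq i - C" for v
      using that V pos_props[of v] degree_proj[of v] len by (auto simp: R_def)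
    then have "P (seq i) - B (seq i) \<subseteq> R" using PB[OF i] by auto
    moreover have "card (P (seq i)) = card S" using inj[OF i] card[OF i] by (simp add: P_def card_image)
    moreover have "free_conf h (P (seq i)) (B (seq i))"
      unfolding P_def B_def by (rule gp_set_free_conf[OF gp[OF i] len])
    ultimately show ?thesis using large by (simp add: conf_def)
  qed
  have side_step: "side \<sigma> (P (seq (Suc i))) (B (seq (Suc i)))"
    if i: "i < M" and sd: "side \<sigma> (P (seq i)) (B (seq i))" for i \<sigma>
  proof -
    let ?S = "seq i" and ?S' = "seq (Suc i)"
    obtain u v where uv: "u \<in> ?S" "v \<notin> ?S" "E u v" "?S' = insert v (?S - {u})"
      using st[OF i] unfolding step_def by blast
    have le: "i \<le> M" "Suc i \<le> M" using i by auto
    have same: "P ?S' = P ?S" if "pos u = pos v"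
    proof -
      have "P ?S' = insert (pos u) (pos ` (?S - {u}))" using uv(4) that by (simp add: P_def)
      also have "\<dots> = pos ` insert u (?S - {u})" by (simp only: image_insert)
      also have "insert u (?S - {u}) = ?S" using uv(1) by blast
      finally show ?thesis by (simp add: P_def)
    qed
    show ?thesis using uv(3)
    proof (cases rule: edge_cases)
      case cycle
      \<comment> \<open>A move along the cycle leaves the off-cycle robots alone, and
        \<open>side\<close> looks only at them while the cycle is occupied.\<close>
      have "?S' - C = ?S - C" using uv cycle by auto
      then have "P ?S' - B ?S' = P ?S - B ?S" using PB le by simp
      moreover have "B ?S \<noteq> {}" "B ?S' \<noteq> {}" using uv cycle by (auto simp: B_def)
      ultimately show ?thesis using sd by (simp add: side_def)
    next
      case up
      then have "pos u = pos v" using pos_par[of u] uv E_in by auto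
      note P = same[OF this]
      show ?thesis
      proof (cases "v \<in> C")
        case True
        then have "?S' \<inter> C = insert v (?S \<inter> C)" using uv up by auto
        then have "B ?S' = insert (pos v) (B ?S)" by (simp add: B_def)
        then show ?thesis using side_leave_tree[of "P ?S" "B ?S" "pos v"] conf[OF le(1)] conf[OF le(2)] P sd by simp
      next
        case False
        then have "?S' \<inter> C = ?S \<inter> C" using uv up by auto
        then show ?thesis using P sd by (simp add: B_def)
      qed
    next
      case down
      then have "pos u = pos v" using pos_par[of v] uv E_in by auto
      note P = same[OF this]
      show ?thesis
      proof (cases "u \<in> C")
        case True
        then have "?S \<inter> C = insert u (?S' \<inter> C)" using uv down by auto
        then have "B ?S = insert (pos u) (B ?S')" by (simp add: B_def)
        then show ?thesis using side_enter_tree[of "P ?S" "pos u" "B ?S'"] conf[OF le(1)] conf[OF le(2)] P sd by simp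
      next
        case False
        then have "?S' \<inter> C = ?S \<inter> C" using uv down by auto
        then show ?thesis using P sd by (simp add: B_def)
      qed
    qed
  qed
  have side_later: "side \<sigma> (P (seq j)) (B (seq j))"
    if "i \<le> j" "j \<le> M" "side \<sigma> (P (seq i)) (B (seq i))" for i j \<sigma>
    using that(1,2)
  proof (induction j rule: dec_induct)
    case base
    then show ?case using that by simp
  next
    case (step n)
    then show ?case using side_step[of n \<sigma>] by simp
  qed
  have visit: "\<exists>i\<le>M. q \<in> B (seq i)" if "q < length c" for q
  proof -
    have "c ! q \<in> V" "c ! q \<in> C" using that c_V by auto
    then obtain i where "i \<le> M" "c ! q \<in> seq i" using cover by blast
    then show ?thesis using \<open>c ! q \<in> C\<close> pos_nth[OF that] by (auto simp: B_def intro!: image_eqI[of q pos "c ! q"])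
  qed
  \<comment> \<open>The order of the two visits is unknown; the value of \<open>side\<close> is
    carried from the earlier to the later one.\<close>
  obtain i j where ij: "i \<le> M" "h \<in> B (seq i)" "j \<le> M" "0 \<in> B (seq j)"
    using visit[of h] visit[of 0] len c_length by auto
  obtain \<sigma> \<tau> where s: "side \<sigma> (P (seq i)) (B (seq i))" and t: "side \<tau> (P (seq j)) (B (seq j))"
    using ex_side conf ij by (metis empty_iff)
  have "\<not> \<sigma>" using side_boundary_h[OF conf[OF ij(1)] ij(2) s] .
  moreover have \<tau> using side_boundary_0[OF conf[OF ij(3)] ij(4) t] .
  ultimately show False
    using side_later[of i j \<sigma>] side_later[of j i \<tau>] s t ij
      side_boundary_0[OF conf[OF ij(3)] ij(4), of \<sigma>] side_boundary_h[OF conf[OF ij(1)] ij(2), of \<tau>]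
    by (metis nat_le_linear)
qed

end

section \<open>Rotating the cycle to balance the cut\<close>

lemma is_cycle_rotate:
  assumes "is_cycle V E c"
  shows "is_cycle V E (rotate r c)"
  unfolding is_cycle_def
proof (intro conjI allI impI)
  fix i assume "i < length (rotate r c)"
  then have i: "i < length c" by simp
  let ?n = "length c"
  have n: "0 < ?n" using i by linarith
  have "rotate r c ! (Suc i mod ?n) = c ! ((r + Suc i mod ?n) mod ?n)"
    using n by (intro nth_rotate) simp
  also have "(r + Suc i mod ?n) mod ?n = Suc ((r + i) mod ?n) mod ?n"
    by (simp add: mod_add_right_eq mod_Suc_eq)
  finally have "rotate r c ! (Suc i mod ?n) = c ! (Suc ((r + i) mod ?n) mod ?n)" .
  moreover have "rotate r c ! i = c ! ((r + i) mod ?n)" using i by (intro nth_rotate)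
  moreover have "E (c ! ((r + i) mod ?n)) (c ! (Suc ((r + i) mod ?n) mod ?n))"
    using assms n unfolding is_cycle_def by simp
  ultimately show "E (rotate r c ! i) (rotate r c ! (Suc i mod length (rotate r c)))" by simp
qed (use assms in \<open>auto simp: is_cycle_def\<close>)

text \<open>A discrete intermediate value argument: the two halves exchange their roles when the cycle
  is rotated by \<open>h\<close>.\<close>

lemma ex_balanced_rotation:
  fixes Q :: "'a \<Rightarrow> bool"
  assumes len: "length c = 2 * h" and "distinct c" and k: "k = card {v \<in> set c. Q v}" and "even k"
    and "0 < h"
  shows "\<exists>r. card ({i. i < 2 * h \<and> Q (rotate r c ! i)} \<inter> {..<h}) = k div 2 \<and>
    card ({i. i < 2 * h \<and> Q (rotate r c ! i)} \<inter> {h..}) = k div 2"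
proof -
  define g :: "nat \<Rightarrow> int" where "g n = of_bool (Q (c ! (n mod (2 * h))))" for n
  \<comment> \<open>Number of marks in the window of length \<open>h\<close> starting at
    \<open>r\<close>. Shifting by one drops one vertex and gains one, and the windows at
    \<open>0\<close> and \<open>h\<close> together hold all \<open>k\<close> marks.\<close>
  define f where "f r = (\<Sum>i<h. g (r + i))" for r
  have card_half: "int (card ({i. i < 2 * h \<and> Q (rotate r c ! i)} \<inter> {..<h})) = f r" for r
  proof -
    have "{i. i < 2 * h \<and> Q (rotate r c ! i)} \<inter> {..<h} = {..<h} \<inter> {i. Q (c ! ((r + i) mod (2 * h)))}"
      using len by (auto simp: nth_rotate)
    then show ?thesis by (simp add: f_def g_def sum_of_bool_eq)
  qed
  have card_all: "card {i. i < 2 * h \<and> Q (rotate r c ! i)} = k" for r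
  proof -
    have *: "card {i. i < length d \<and> Q (d ! i)} = card {v \<in> set d. Q v}" if "distinct d" for d
    proof -
      have "inj_on (nth d) {i. i < length d \<and> Q (d ! i)}"
        using that by (auto simp: inj_on_def nth_eq_iff_index_eq)
      moreover have "nth d ` {i. i < length d \<and> Q (d ! i)} = {v \<in> set d. Q v}"
        by (auto simp: in_set_conv_nth)
      ultimately show ?thesis by (metis card_image)
    qed
    show ?thesis using *[of "rotate r c"] assms(2) len k by simp
  qed
  have card_split: "card ({i. i < 2 * h \<and> Q (rotate r c ! i)} \<inter> {..<h}) +
    card ({i. i < 2 * h \<and> Q (rotate r c ! i)} \<inter> {h..}) = k" for r
  proof -
    let ?A = "{i. i < 2 * h \<and> Q (rotate r c ! i)}"
    have "card ?A = card (?A \<inter> {..<h} \<union> ?A \<inter> {h..})" by (rule arg_cong[of _ _ card]) auto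
    also have "\<dots> = card (?A \<inter> {..<h}) + card (?A \<inter> {h..})" by (rule card_Un_disjoint) auto
    finally show ?thesis using card_all by simp
  qed
  have "(\<Sum>i<h + n. g i) = f 0 + (\<Sum>i<n. g (h + i))" for n
    by (induction n) (simp_all add: f_def)
  then have "f 0 + f h = (\<Sum>i<h + h. g i)"
    by (simp add: f_def)
  also have "\<dots> = int (card {i. i < 2 * h \<and> Q (rotate 0 c ! i)})"
  proof -
    have "(\<Sum>i<h + h. g i) = (\<Sum>i<2 * h. of_bool (Q (c ! i)))"
      by (intro sum.cong) (auto simp: g_def)
    also have "\<dots> = int (card ({..<2 * h} \<inter> {i. Q (c ! i)}))" by (simp add: sum_of_bool_eq)
    also have "{..<2 * h} \<inter> {i. Q (c ! i)} = {i. i < 2 * h \<and> Q (rotate 0 c ! i)}" by auto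
    finally show ?thesis .
  qed
  finally have sum: "f 0 + f h = int k" using card_all[of 0] by simp
  have diff: "\<bar>f (i + 1) - f i\<bar> \<le> 1" for i
  proof -
    have "f i + g (i + h) = (\<Sum>j<Suc h. g (i + j))" by (simp add: f_def)
    also have "\<dots> = g i + f (i + 1)" by (subst sum.lessThan_Suc_shift) (simp add: f_def)
    finally have "f (i + 1) - f i = g (i + h) - g i" by simp
    moreover have "g n = 0 \<or> g n = 1" for n by (simp add: g_def)
    from this[of i] this[of "i + h"] have "\<bar>g (i + h) - g i\<bar> \<le> 1" by auto
    ultimately show ?thesis by simp
  qed
  have "\<exists>r. f r = int (k div 2)"
  proof (cases "f 0 \<le> int (k div 2)")
    case True
    then have "int (k div 2) \<le> f h" using sum \<open>even k\<close> by (auto elim!: evenE)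
    then show ?thesis using nat0_intermed_int_val[of h f "int (k div 2)"] True diff by auto
  next
    case False
    \<comment> \<open>The intermediate value lemma expects a start below the target, so
      \<open>f\<close> is negated.\<close>
    then have "- int (k div 2) \<le> - f h" using sum \<open>even k\<close> by (auto elim!: evenE)
    moreover have "\<bar>- f (i + 1) - - f i\<bar> \<le> 1" for i using diff[of i] by linarith
    ultimately have "\<exists>i\<le>h. - f i = - int (k div 2)"
      using False by (intro nat0_intermed_int_val) auto
    then show ?thesis by auto
  qed
  then obtain r where "f r = int (k div 2)" by blast
  then have "card ({i. i < 2 * h \<and> Q (rotate r c ! i)} \<inter> {..<h}) = k div 2"
    using card_half[of r] by simp
  then show ?thesis using card_split[of r] \<open>even k\<close> by (intro exI[of _ r]) (auto elim!: evenE)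
qed

lemma unicyclic_graphI:
  assumes "unicyclic V E" "is_cycle V E c"
  shows "unicyclic_graph V E c"
proof
  fix c' assume "is_cycle V E c'"
  then show "cycle_edges c' = cycle_edges c"
    using assms unfolding unicyclic_def by metis
qed (use assms in \<open>auto simp: unicyclic_def\<close>)

lemma finite_mobile_gp_sets: "finite V \<Longrightarrow> finite {S. mobile_gp_set V E S}"
  by (rule finite_subset[of _ "Pow V"]) (auto simp: mobile_gp_set_def gp_set_def)

lemma mob_le:
  assumes uni: "unicyclic V E" and cyc: "is_cycle V E c"
    and k: "k = card {v \<in> set c. 3 \<le> degree V E v}" "2 \<le> k" "even k" and "even (length c)"
  shows "mob V E \<le> k div 2 + 2"
proof -
  obtain h where len: "length c = 2 * h" using \<open>even (length c)\<close> by blast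
  have h: "0 < h" using cyc len by (auto simp: is_cycle_def)
  have "distinct c" using cyc by (simp add: is_cycle_def)
  obtain r where r: "card ({i. i < 2 * h \<and> 3 \<le> degree V E (rotate r c ! i)} \<inter> {..<h}) = k div 2"
    "card ({i. i < 2 * h \<and> 3 \<le> degree V E (rotate r c ! i)} \<inter> {h..}) = k div 2"
    using ex_balanced_rotation[OF len \<open>distinct c\<close> k(1,3) h] by blast
  interpret unicyclic_graph V E "rotate r c"
    using unicyclic_graphI[OF uni is_cycle_rotate[OF cyc]] .
  have "balanced_marking h (k div 2) {i. i < 2 * h \<and> 3 \<le> degree V E (rotate r c ! i)}"
    by unfold_locales (use r k(2) in auto)
  then have le: "card S \<le> k div 2 + 2" if "mobile_gp_set V E S" for S
    using mobile_card_le len that by simp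
  have "c ! 0 \<in> V" using cyc h len nth_mem[of 0 c] by (auto simp: is_cycle_def)
  then have "{S. mobile_gp_set V E S} \<noteq> {}" using mobile_gp_set_singleton by blast
  then show ?thesis unfolding mob_def
    using le finite_mobile_gp_sets[OF finite_V] by (subst Max_le_iff) auto
qed

section \<open>A graph attaining the bound\<close>

text \<open>The 4-cycle \<open>0, 1, 2, 3\<close> with a leaf \<open>4\<close> at \<open>0\<close> and a leaf \<open>5\<close> at \<open>1\<close>. Three robots traverse it
  by \<open>{1, 3, 4}\<close>, \<open>{3, 4, 5}\<close>, \<open>{2, 4, 5}\<close>, \<open>{0, 2, 5}\<close>.\<close>

definition ex_V :: "nat set" where "ex_V = {0, 1, 2, 3, 4, 5}"

definition ex_E :: "nat \<Rightarrow> nat \<Rightarrow> bool" where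
  "ex_E u v \<longleftrightarrow> (u, v) \<in> {(0,1), (1,2), (2,3), (3,0), (0,4), (1,5), (1,0), (2,1), (3,2), (0,3), (4,0), (5,1)}"

definition ex_cycle :: "nat list" where "ex_cycle = [0, 1, 2, 3]"

lemma ex_E_sym: "ex_E u v \<Longrightarrow> ex_E v u"
  by (auto simp: ex_E_def)

lemma ex_simple: "simple_graph ex_V ex_E"
  unfolding simple_graph_def by (auto simp: ex_E_def ex_V_def)

text \<open>A precomputed distance matrix. The Lipschitz property certifies it from below, the
  existence of a neighbour one step closer from above.\<close>

definition ex_dist :: "nat \<Rightarrow> nat \<Rightarrow> nat" where
  "ex_dist u v = [[0,1,2,1,1,2], [1,0,1,2,2,1], [2,1,0,1,3,2], [1,2,1,0,2,3], [1,2,3,2,0,3], [2,1,2,3,3,0]] ! u ! v"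

lemma ex_dist_self: "u \<in> ex_V \<Longrightarrow> ex_dist u u = 0"
  by (auto simp: ex_V_def ex_dist_def)

lemma ex_dist_lipschitz: "u \<in> ex_V \<Longrightarrow> ex_E v w \<Longrightarrow> ex_dist u w \<le> Suc (ex_dist u v)"
  unfolding ex_E_def ex_V_def insert_iff empty_iff prod.inject
  by (elim disjE conjE FalseE; simp add: ex_dist_def)

lemma ex_dist_descent:
  "u \<in> ex_V \<Longrightarrow> v \<in> ex_V \<Longrightarrow> u \<noteq> v \<Longrightarrow> \<exists>w\<in>ex_V. ex_E w v \<and> Suc (ex_dist u w) = ex_dist u v"
  unfolding ex_V_def insert_iff empty_iff
  by (elim disjE FalseE; simp add: ex_dist_def ex_E_def)

lemma ex_dist_relpowp:
  assumes "u \<in> ex_V" "v \<in> ex_V"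
  shows "(ex_E ^^ ex_dist u v) u v"
  using assms(2)
proof (induction "ex_dist u v" arbitrary: v rule: less_induct)
  case less
  show ?case
  proof (cases "u = v")
    case True
    then have "ex_dist u v = 0" using ex_dist_self assms(1) by simp
    then show ?thesis using True by simp
  next
    case False
    then obtain w where w: "w \<in> ex_V" "ex_E w v" "Suc (ex_dist u w) = ex_dist u v"
      using ex_dist_descent assms(1) less.prems by blast
    then have "(ex_E ^^ Suc (ex_dist u w)) u v" using less.hyps[of w] by (intro relpowp_Suc_I) auto
    then show ?thesis using w by (simp only:)
  qed
qed

lemma ex_connected: "connected_graph ex_V ex_E"
  unfolding connected_graph_def using iffD2[OF walk_iff_relpowp ex_dist_relpowp] by blast

lemma ex_gdist:
  assumes "u \<in> ex_V" "v \<in> ex_V"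
  shows "gdist ex_E u v = ex_dist u v"
proof (rule antisym)
  show "gdist ex_E u v \<le> ex_dist u v" using ex_dist_relpowp[OF assms] by (rule gdist_le)
  have "(ex_E ^^ gdist ex_E u v) u v" using ex_dist_relpowp[OF assms] by (rule gdist_relpowp)
  moreover have "int (ex_dist u y) \<le> int (ex_dist u x) + 1" if "ex_E x y" for x y
    using ex_dist_lipschitz[OF assms(1) that] by simp
  ultimately have "int (ex_dist u v) \<le> int (ex_dist u u) + int (gdist ex_E u v)"
    by (intro relpowp_lipschitz[of ex_E "\<lambda>x. int (ex_dist u x)"]) auto
  then show "ex_dist u v \<le> gdist ex_E u v" using ex_dist_self[OF assms(1)] by simp
qed

text \<open>Three vertices on a shortest path make the triangle inequality an equality in some
  order; the six hypotheses exclude all orders.\<close>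

lemma ex_gp_set:
  assumes "S = {a, b, d}" "S \<subseteq> ex_V"
    and "ex_dist a b + ex_dist b d \<noteq> ex_dist a d" "ex_dist b a + ex_dist a d \<noteq> ex_dist b d"
      "ex_dist a d + ex_dist d b \<noteq> ex_dist a b" "ex_dist d b + ex_dist b a \<noteq> ex_dist d a"
      "ex_dist d a + ex_dist a b \<noteq> ex_dist d b" "ex_dist b d + ex_dist d a \<noteq> ex_dist b a"
  shows "gp_set ex_V ex_E S"
  unfolding gp_set_def
proof (intro conjI ballI impI notI)
  fix u v w
  assume S: "u \<in> S" "v \<in> S" "w \<in> S" and ne: "u \<noteq> v \<and> v \<noteq> w \<and> u \<noteq> w"
    and "\<exists>p. shortest_path ex_E p \<and> u \<in> set p \<and> v \<in> set p \<and> w \<in> set p"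
  then obtain x y z where xyz: "{x, y, z} = {u, v, w}" "gdist ex_E x y + gdist ex_E y z = gdist ex_E x z"
    using shortest_path_collinear by metis
  have "{x, y, z} \<subseteq> S" unfolding xyz(1) using S by simp
  then have "x \<in> S" "y \<in> S" "z \<in> S" by simp_all
  have "card {x, y, z} = 3" using xyz(1) ne by simp
  then have "x \<noteq> y" "y \<noteq> z" "x \<noteq> z" by (auto simp: card_insert_if split: if_splits)
  moreover have "ex_dist x y + ex_dist y z = ex_dist x z"
    using xyz(2) ex_gdist assms(2) \<open>x \<in> S\<close> \<open>y \<in> S\<close> \<open>z \<in> S\<close> by (metis subsetD)
  ultimately show False
    using assms(3-) \<open>x \<in> S\<close> \<open>y \<in> S\<close> \<open>z \<in> S\<close> unfolding assms(1) by blast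
qed (use assms(2) in blast)

lemma ex_gp_sets:
  "gp_set ex_V ex_E {1, 3, 4}" "gp_set ex_V ex_E {3, 4, 5}" "gp_set ex_V ex_E {2, 4, 5}"
  "gp_set ex_V ex_E {0, 2, 5}"
  by (rule ex_gp_set[OF refl]; simp add: ex_V_def ex_dist_def)+

lemma ex_mobile: "mobile_gp_set ex_V ex_E {1, 3, 4}"
proof -
  define seq :: "nat \<Rightarrow> nat set" where
    "seq i = [{1, 3, 4}, {3, 4, 5}, {2, 4, 5}, {0, 2, 5}] ! i" for i
  have "legal_move ex_V ex_E {1, 3, 4} {3, 4, 5}"
    unfolding legal_move_def
    by (rule exI[of _ 1], rule exI[of _ 5]) (use ex_gp_sets in \<open>auto simp: ex_E_def ex_V_def\<close>)
  moreover have "legal_move ex_V ex_E {3, 4, 5} {2, 4, 5}"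
    unfolding legal_move_def
    by (rule exI[of _ 3], rule exI[of _ 2]) (use ex_gp_sets in \<open>auto simp: ex_E_def ex_V_def\<close>)
  moreover have "legal_move ex_V ex_E {2, 4, 5} {0, 2, 5}"
    unfolding legal_move_def
    by (rule exI[of _ 4], rule exI[of _ 0]) (use ex_gp_sets in \<open>auto simp: ex_E_def ex_V_def\<close>)
  ultimately have "\<forall>i<3. legal_move ex_V ex_E (seq i) (seq (Suc i))"
    by (auto simp: seq_def less_Suc_eq numeral_3_eq_3)
  moreover have "(\<Union>i\<le>3. seq i) = ex_V"
    by (auto simp: seq_def ex_V_def atMost_Suc numeral_3_eq_3)
  moreover have "seq 0 = {1, 3, 4}" by (simp add: seq_def)
  ultimately show ?thesis unfolding mobile_gp_set_def using ex_gp_sets by blast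
qed

lemma ex_is_cycle: "is_cycle ex_V ex_E ex_cycle"
  unfolding is_cycle_def
proof (intro conjI allI impI)
  fix i assume "i < length ex_cycle"
  then have "i = 0 \<or> i = 1 \<or> i = 2 \<or> i = 3" by (auto simp: ex_cycle_def)
  then show "ex_E (ex_cycle ! i) (ex_cycle ! (Suc i mod length ex_cycle))"
    by (elim disjE) (simp_all add: ex_cycle_def ex_E_def)
qed (simp_all add: ex_cycle_def ex_V_def)

text \<open>Leaves lie on no cycle, and parity excludes triangles. In a 4-cycle, opposite vertices
  are the two of equal parity, which fixes the edge set.\<close>

lemma ex_cycle_unique:
  assumes "is_cycle ex_V ex_E c"
  shows "cycle_edges c = cycle_edges ex_cycle"
proof -
  let ?n = "length c"
  have n: "3 \<le> ?n" "distinct c" "set c \<subseteq> ex_V" and e: "\<And>i. i < ?n \<Longrightarrow> ex_E (c ! i) (c ! (Suc i mod ?n))"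
    using assms by (auto simp: is_cycle_def)
  have two: "\<exists>x y. x \<noteq> y \<and> ex_E v x \<and> ex_E v y" if v: "v \<in> set c" for v
  proof -
    obtain i where i: "i < ?n" "c ! i = v" using v by (auto simp: in_set_conv_nth)
    define j where "j = (if i = 0 then ?n - 1 else i - 1)"
    have j: "j < ?n" "Suc j mod ?n = i" "j \<noteq> Suc i mod ?n" "Suc i mod ?n < ?n"
      using i(1) n by (auto simp: j_def mod_Suc)
    then have "ex_E v (c ! j)" "ex_E v (c ! (Suc i mod ?n))" using e[OF i(1)] e[OF j(1)] i ex_E_sym by auto
    moreover have "c ! j \<noteq> c ! (Suc i mod ?n)" using j n by (simp add: nth_eq_iff_index_eq)
    ultimately show ?thesis by blast
  qed
  have "4 \<notin> set c" "5 \<notin> set c" using two[of 4] two[of 5] by (auto simp: ex_E_def)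
  then have sub: "set c \<subseteq> {0, 1, 2, 3}" using n(3) by (auto simp: ex_V_def)
  have "?n = card (set c)" using n by (simp add: distinct_card)
  also have "\<dots> \<le> card {0, 1, 2, 3::nat}" using sub by (intro card_mono) auto
  finally have "?n \<le> 4" by simp
  \<comment> \<open>Parity of the labels is a proper 2-colouring of the square.\<close>
  have odd_sum: "odd (x + y)" if "ex_E x y" "x \<in> {0, 1, 2, 3}" "y \<in> {0, 1, 2, 3}" for x y
    using that(1) unfolding ex_E_def by (elim insertE emptyE; insert that(2,3); simp)
  from \<open>?n \<le> 4\<close> consider "?n = 3" | "?n = 4" using n by linarith
  then show ?thesis
  proof cases
    case 1
    then obtain x y z where c: "c = [x, y, z]" by (auto simp: length_Suc_conv numeral_3_eq_3)
    have D: "x \<in> {0, 1, 2, 3}" "y \<in> {0, 1, 2, 3}" "z \<in> {0, 1, 2, 3}"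
      using sub unfolding c by simp_all
    have "ex_E x y" "ex_E y z" "ex_E z x" using e[of 0] e[of 1] e[of 2] unfolding c by simp_all
    then have "odd (x + y)" "odd (y + z)" "odd (z + x)"
      using odd_sum[OF _ D(1,2)] odd_sum[OF _ D(2,3)] odd_sum[OF _ D(3,1)] by blast+
    then show ?thesis by presburger
  next
    case 2
    then obtain x y z w where c: "c = [x, y, z, w]" by (auto simp: length_Suc_conv numeral_eq_Suc)
    have edges: "cycle_edges [x, y, z, w] = {{x, y}, {y, z}, {z, w}, {w, x}}" for x y z w :: nat
    proof -
      have "cycle_edges [x, y, z, w] = (\<lambda>i. {[x, y, z, w] ! i, [x, y, z, w] ! (Suc i mod 4)}) ` {..<4}"
        unfolding cycle_edges_def by auto
      also have "{..<4::nat} = {0, 1, 2, 3}" by auto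
      finally show ?thesis by simp
    qed
    have D: "x \<in> {0, 1, 2, 3}" "y \<in> {0, 1, 2, 3}" "z \<in> {0, 1, 2, 3}" "w \<in> {0, 1, 2, 3}"
      using sub unfolding c by simp_all
    have "ex_E x y" "ex_E y z" "ex_E z w" using e[of 0] e[of 1] e[of 2] unfolding c by simp_all
    then have odd: "odd (x + y)" "odd (y + z)" "odd (z + w)"
      using odd_sum[OF _ D(1,2)] odd_sum[OF _ D(2,3)] odd_sum[OF _ D(3,4)] by blast+
    have le: "x \<le> 3" "y \<le> 3" "z \<le> 3" "w \<le> 3"
      using subsetD[OF sub, of x] subsetD[OF sub, of y] subsetD[OF sub, of z] subsetD[OF sub, of w]
      unfolding c by auto
    have ne: "x \<noteq> z" "y \<noteq> w" using n(2) c by auto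
    have "x = 0 \<and> z = 2 \<or> x = 2 \<and> z = 0 \<or> x = 1 \<and> z = 3 \<or> x = 3 \<and> z = 1"
      using odd le ne by presburger
    moreover have "y = 0 \<and> w = 2 \<or> y = 2 \<and> w = 0 \<or> y = 1 \<and> w = 3 \<or> y = 3 \<and> w = 1"
      using odd le ne by presburger
    ultimately show ?thesis using odd(1) unfolding c ex_cycle_def edges
      by (elim disjE conjE; simp add: insert_commute)
  qed
qed

lemma ex_unicyclic: "unicyclic ex_V ex_E"
  unfolding unicyclic_def
proof (intro conjI ex1I[of _ "cycle_edges ex_cycle"])
  show "\<exists>c. is_cycle ex_V ex_E c \<and> cycle_edges ex_cycle = cycle_edges c" using ex_is_cycle by blast
  fix C assume "\<exists>c. is_cycle ex_V ex_E c \<and> C = cycle_edges c"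
  then show "C = cycle_edges ex_cycle" using ex_cycle_unique by blast
qed (rule ex_simple, rule ex_connected)

lemma ex_degrees: "{v \<in> set ex_cycle. 3 \<le> degree ex_V ex_E v} = {0, 1}"
proof -
  have "{u \<in> ex_V. ex_E 0 u} = {1, 3, 4}" "{u \<in> ex_V. ex_E 1 u} = {0, 2, 5}"
    "{u \<in> ex_V. ex_E 2 u} = {1, 3}" "{u \<in> ex_V. ex_E 3 u} = {0, 2}"
    by (auto simp: ex_E_def ex_V_def)
  then have "degree ex_V ex_E 0 = 3" "degree ex_V ex_E 1 = 3" "degree ex_V ex_E 2 = 2" "degree ex_V ex_E 3 = 2"
    by (simp_all add: degree_def)
  then show ?thesis by (auto simp: ex_cycle_def)
qed

lemma ex_mob: "mob ex_V ex_E = 3"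
proof (rule antisym)
  show "mob ex_V ex_E \<le> 3"
    using mob_le[OF ex_unicyclic ex_is_cycle refl] by (simp add: ex_degrees) (simp add: ex_cycle_def)
  have "card {1, 3, 4::nat} \<le> mob ex_V ex_E"
    unfolding mob_def using ex_mobile finite_mobile_gp_sets[of ex_V ex_E]
    by (intro Max_ge finite_imageI imageI) (auto simp: ex_V_def)
  then show "3 \<le> mob ex_V ex_E" by simp
qed

theorem theorem2p4:
  shows "(\<forall>(V :: 'a set) E c k. unicyclic V E \<longrightarrow> is_cycle V E c \<longrightarrow>
            k = card {v \<in> set c. 3 \<le> degree V E v} \<longrightarrow> 2 \<le> k \<longrightarrow>
            even k \<longrightarrow> even (length c) \<longrightarrow> mob V E \<le> k div 2 + 2)
       \<and> (\<exists>(V :: nat set) E c k. unicyclic V E \<and> is_cycle V E c \<and>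
            k = card {v \<in> set c. 3 \<le> degree V E v} \<and> 2 \<le> k \<and>
            even k \<and> even (length c) \<and> mob V E = k div 2 + 2)"
proof (intro conjI allI impI)
  fix V :: "'a set" and E c k
  assume "unicyclic V E" "is_cycle V E c" "k = card {v \<in> set c. 3 \<le> degree V E v}" "2 \<le> k"
    "even k" "even (length c)"
  then show "mob V E \<le> k div 2 + 2" by (rule mob_le)
next
  show "\<exists>(V :: nat set) E c k. unicyclic V E \<and> is_cycle V E c \<and>
            k = card {v \<in> set c. 3 \<le> degree V E v} \<and> 2 \<le> k \<and>
            even k \<and> even (length c) \<and> mob V E = k div 2 + 2"
    using ex_unicyclic ex_is_cycle ex_degrees ex_mob
    by (intro exI[of _ ex_V] exI[of _ ex_E] exI[of _ ex_cycle] exI[of _ 2]) (simp add: ex_cycle_def)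
qed

end
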